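(* Let $\lambda>0$ and $f\in L^2(X,\nu)$, and let $(T_\lambda(t))_{t\ge0}$ be the semigroup solution of the Cauchy problem $$v_t\in\Delta_1^m v(t)-\lambda(v(t)-f)\ \text{ in }(0,\infty)\times X,\qquad v(0,x)=v_0(x)\ \text{ for }x\in X.$$ Then, for every $v_0\in L^2(X,\nu)$, $$\|T_\lambda(t)v_0-u_\lambda\|_{L^2(X,\nu)}\le\|v_0-u_\lambda\|_{L^2(X,\nu)}\,e^{-\lambda t}\quad\text{for all }t\ge0,$$ where $u_\lambda$ is the unique minimizer, over $u\in L^2(X,\nu)$, of $TV_m(u)+\frac\lambda2\int_X|u-f|^2\,d\nu$ (with the same $f$).
   Context: Setting: $(X,d)$ is a Polish metric space with its Borel $\sigma$-algebra. A random walk $m=(m_x)_{x\in X}$ on $X$ is a family of Borel probability measures on $X$ such that $x\mapsto m_x(A)$ is Borel for every Borel $A\subset X$ and $\int_X d(z,y)\,dm_x(y)<\infty$ for all $x\in X$ and some (hence any) $z\in X$; $[X,d,m]$ is a metric random walk space. $\nu$ is a finite (nonzero) Radon measure on $X$ which is reversible for $m$: $dm_x(y)d\nu(x)=dm_y(x)d\nu(y)$ as measures on $X\times X$ (this implies invariance, $\nu(A)=\int_X m_x(A)\,d\nu(x)$). It is also assumed that $\frac1{\nu(X)}\nu$ is ergodic with respect to $m$: every Borel set $B$ with $m_x(B)=1$ for all $x\in B$ satisfies $\nu(B)=0$ or $\nu(B)=\nu(X)$. $m$-total variation: $TV_m(u)=\frac12\int_X\int_X|u(y)-u(x)|\,dm_x(y)\,d\nu(x)$.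 $\mathcal F_m:L^2(X,\nu)\to\,]-\infty,+\infty]$, $\mathcal F_m(u)=TV_m(u)$, is convex and lower semicontinuous; $\partial\mathcal F_m$ is its subdifferential in $L^2(X,\nu)$. The multivalued operator $\Delta_1^m$ in $L^2(X,\nu)$ is defined by: $v\in\Delta_1^m(u)$ iff $-v\in\partial\mathcal F_m(u)$. For each $v_0\in L^2(X,\nu)$, $v(t)=T_\lambda(t)v_0$ denotes the unique strong solution of the Cauchy problem, i.e. for every $T>0$, $v\in C([0,T];L^2(X,\nu))\cap W^{1,1}_{loc}(0,T;L^2(X,\nu))$, $v(0)=v_0$, and $\lambda(v(t)-f)+v_t(t)\in\Delta_1^m(v(t))$ for almost every $t\in(0,T)$. *)

theory Defs
  imports "HOL-Probability.Probability"
begin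

section \<open>Metric random walk spaces\<close>

definition random_walk :: "('a::polish_space \<Rightarrow> 'a measure) \<Rightarrow> bool" where
  "random_walk m \<longleftrightarrow>
     (\<forall>x. prob_space (m x) \<and> sets (m x) = sets borel) \<and>
     (\<forall>A\<in>sets borel. (\<lambda>x. measure (m x) A) \<in> borel_measurable borel) \<and>
     (\<exists>z. \<forall>x. integrable (m x) (\<lambda>y. dist z y))"

text \<open>Equality of the measures \<open>dm\<^sub>x(y) d\<nu>(x)\<close> and \<open>dm\<^sub>y(x) d\<nu>(y)\<close> on the Borel sets of the
  product space.\<close>

definition reversible :: "('a::polish_space \<Rightarrow> 'a measure) \<Rightarrow> 'a measure \<Rightarrow> bool" where
  "reversible m \<nu> \<longleftrightarrow>
     (\<forall>C\<in>sets (borel :: ('a \<times> 'a) measure).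
        (\<integral>\<^sup>+x. (\<integral>\<^sup>+y. indicator C (x, y) \<partial>m x) \<partial>\<nu>) = (\<integral>\<^sup>+y. (\<integral>\<^sup>+x. indicator C (x, y) \<partial>m y) \<partial>\<nu>))"

definition ergodic :: "('a::polish_space \<Rightarrow> 'a measure) \<Rightarrow> 'a measure \<Rightarrow> bool" where
  "ergodic m \<nu> \<longleftrightarrow>
     (\<forall>B\<in>sets borel. (\<forall>x\<in>B. emeasure (m x) B = 1) \<longrightarrow>
        emeasure \<nu> B = 0 \<or> emeasure \<nu> B = emeasure \<nu> UNIV)"

text \<open>A finite Borel measure on a Polish space is automatically Radon, so no separate regularity
  clause is imposed on \<open>\<nu>\<close>.\<close>

definition reversible_ergodic_space :: "('a::polish_space \<Rightarrow> 'a measure) \<Rightarrow> 'a measure \<Rightarrow> bool" where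
  "reversible_ergodic_space m \<nu> \<longleftrightarrow>
     random_walk m \<and> sets \<nu> = sets borel \<and> finite_measure \<nu> \<and> emeasure \<nu> UNIV \<noteq> 0 \<and>
     reversible m \<nu> \<and> ergodic m \<nu>"


section \<open>The space of square-integrable functions\<close>

text \<open>Elements of \<open>L\<^sup>2\<close> are represented by measurable functions, not by equivalence classes;
  equality in \<open>L\<^sup>2\<close> is equality almost everywhere.\<close>

definition L2 :: "'a measure \<Rightarrow> ('a \<Rightarrow> real) set" where
  "L2 M = {u \<in> borel_measurable M. integrable M (\<lambda>x. (u x)\<^sup>2)}"

definition L2_norm :: "'a measure \<Rightarrow> ('a \<Rightarrow> real) \<Rightarrow> real" where
  "L2_norm M u = sqrt (\<integral>x. (u x)\<^sup>2 \<partial>M)"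

definition L2_continuous_on :: "'a measure \<Rightarrow> real set \<Rightarrow> (real \<Rightarrow> 'a \<Rightarrow> real) \<Rightarrow> bool" where
  "L2_continuous_on M S v \<longleftrightarrow>
     (\<forall>t\<in>S. v t \<in> L2 M) \<and>
     (\<forall>s\<in>S. ((\<lambda>t. L2_norm M (\<lambda>x. v t x - v s x)) \<longlongrightarrow> 0) (at s within S))"

text \<open>The Bochner integral over \<open>[a, b]\<close> of an \<open>L\<^sup>2\<close>-valued function. The library's
  \<^const>\<open>has_bochner_integral\<close> needs a Banach space type as codomain, hence the
  construction is repeated here: the integrand is the almost everywhere limit in norm (strong
  measurability) and the limit in mean of simple functions, whose integrals converge to \<open>I\<close>.\<close>

definition L2_simple_integral ::
    "real \<Rightarrow> real \<Rightarrow> (real \<Rightarrow> 'a \<Rightarrow> real) \<Rightarrow> 'a \<Rightarrow> real" where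
  "L2_simple_integral a b s = (\<lambda>x. \<Sum>y\<in>s ` {a..b}. measure lebesgue {t\<in>{a..b}. s t = y} * y x)"

definition has_L2_integral ::
    "'a measure \<Rightarrow> (real \<Rightarrow> 'a \<Rightarrow> real) \<Rightarrow> real \<Rightarrow> real \<Rightarrow> ('a \<Rightarrow> real) \<Rightarrow> bool" where
  "has_L2_integral M w a b I \<longleftrightarrow>
     (\<forall>t\<in>{a..b}. w t \<in> L2 M) \<and> I \<in> L2 M \<and>
     (\<exists>s :: nat \<Rightarrow> real \<Rightarrow> 'a \<Rightarrow> real.
        (\<forall>n. simple_function (lebesgue_on {a..b}) (s n) \<and> (\<forall>t\<in>{a..b}. s n t \<in> L2 M)) \<and>
        (AE t in lebesgue_on {a..b}. (\<lambda>n. L2_norm M (\<lambda>x. w t x - s n t x)) \<longlonglongrightarrow> 0) \<and>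
        (\<lambda>n. \<integral>\<^sup>+t. ennreal (L2_norm M (\<lambda>x. w t x - s n t x)) \<partial>lebesgue_on {a..b}) \<longlonglongrightarrow> 0 \<and>
        (\<lambda>n. L2_norm M (\<lambda>x. I x - L2_simple_integral a b (s n) x)) \<longlonglongrightarrow> 0)"

text \<open>\<open>v \<in> W\<^sup>1\<^sup>,\<^sup>1\<^sub>l\<^sub>o\<^sub>c(a, b; L\<^sup>2)\<close> with derivative \<open>w\<close>: the function \<open>w\<close> is locally Bochner
  integrable on the open interval and \<open>v\<close> is a primitive of it. The derivative \<open>w\<close> is unique up
  to null sets.\<close>

definition W11_loc_deriv ::
    "'a measure \<Rightarrow> real \<Rightarrow> real \<Rightarrow> (real \<Rightarrow> 'a \<Rightarrow> real) \<Rightarrow> (real \<Rightarrow> 'a \<Rightarrow> real) \<Rightarrow> bool" where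
  "W11_loc_deriv M a b v w \<longleftrightarrow>
     (\<forall>s t. a < s \<and> s \<le> t \<and> t < b \<longrightarrow> has_L2_integral M w s t (\<lambda>x. v t x - v s x))"

definition L2_subdifferential ::
    "'a measure \<Rightarrow> (('a \<Rightarrow> real) \<Rightarrow> ereal) \<Rightarrow> ('a \<Rightarrow> real) \<Rightarrow> ('a \<Rightarrow> real) set" where
  "L2_subdifferential M \<Phi> u =
     {v \<in> L2 M. u \<in> L2 M \<and> \<Phi> u < \<infinity> \<and>
        (\<forall>w\<in>L2 M. \<Phi> u + ereal (\<integral>x. v x * (w x - u x) \<partial>M) \<le> \<Phi> w)}"


section \<open>Total variation flow\<close>

definition TV :: "('a \<Rightarrow> 'a measure) \<Rightarrow> 'a measure \<Rightarrow> ('a \<Rightarrow> real) \<Rightarrow> ennreal" where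
  "TV m \<nu> u = (1 / 2) * (\<integral>\<^sup>+x. (\<integral>\<^sup>+y. ennreal \<bar>u y - u x\<bar> \<partial>m x) \<partial>\<nu>)"

definition one_laplacian ::
    "('a \<Rightarrow> 'a measure) \<Rightarrow> 'a measure \<Rightarrow> ('a \<Rightarrow> real) \<Rightarrow> ('a \<Rightarrow> real) set" where
  "one_laplacian m \<nu> u = {v. (\<lambda>x. - v x) \<in> L2_subdifferential \<nu> (\<lambda>w. enn2ereal (TV m \<nu> w)) u}"

definition strong_solution ::
    "('a \<Rightarrow> 'a measure) \<Rightarrow> 'a measure \<Rightarrow> real \<Rightarrow> ('a \<Rightarrow> real) \<Rightarrow> ('a \<Rightarrow> real) \<Rightarrow>
     (real \<Rightarrow> 'a \<Rightarrow> real) \<Rightarrow> bool" where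
  "strong_solution m \<nu> lam f v0 v \<longleftrightarrow>
     (AE x in \<nu>. v 0 x = v0 x) \<and>
     (\<forall>T>0. L2_continuous_on \<nu> {0..T} v \<and>
        (\<exists>v'. W11_loc_deriv \<nu> 0 T v v' \<and>
           (AE t in lebesgue_on {0<..<T}.
              (\<lambda>x. lam * (v t x - f x) + v' t x) \<in> one_laplacian m \<nu> (v t))))"

definition is_solution_semigroup ::
    "('a \<Rightarrow> 'a measure) \<Rightarrow> 'a measure \<Rightarrow> real \<Rightarrow> ('a \<Rightarrow> real) \<Rightarrow>
     (real \<Rightarrow> ('a \<Rightarrow> real) \<Rightarrow> ('a \<Rightarrow> real)) \<Rightarrow> bool" where
  "is_solution_semigroup m \<nu> lam f T \<longleftrightarrow>
     (\<forall>v0\<in>L2 \<nu>. strong_solution m \<nu> lam f v0 (\<lambda>t. T t v0))"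

definition ROF_energy ::
    "('a \<Rightarrow> 'a measure) \<Rightarrow> 'a measure \<Rightarrow> real \<Rightarrow> ('a \<Rightarrow> real) \<Rightarrow> ('a \<Rightarrow> real) \<Rightarrow> ennreal" where
  "ROF_energy m \<nu> lam f u = TV m \<nu> u + ennreal (lam / 2 * (\<integral>x. \<bar>u x - f x\<bar>\<^sup>2 \<partial>\<nu>))"

definition is_unique_ROF_minimizer ::
    "('a \<Rightarrow> 'a measure) \<Rightarrow> 'a measure \<Rightarrow> real \<Rightarrow> ('a \<Rightarrow> real) \<Rightarrow> ('a \<Rightarrow> real) \<Rightarrow> bool" where
  "is_unique_ROF_minimizer m \<nu> lam f u \<longleftrightarrow>
     is_arg_min (ROF_energy m \<nu> lam f) (\<lambda>w. w \<in> L2 \<nu>) u \<and>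
     (\<forall>w. is_arg_min (ROF_energy m \<nu> lam f) (\<lambda>w. w \<in> L2 \<nu>) w \<longrightarrow> (AE x in \<nu>. w x = u x))"

end

theory Submission
  imports Defs
begin

text \<open>
  The flow is the gradient flow of the energy \<open>TV u + lam/2 \<parallel>u - f\<parallel>\<^sup>2\<close>, which is the sum of a convex
  functional and a quadratic one. It is therefore strongly convex with modulus \<open>lam\<close>, and two
  consequences of that carry the proof.

  First, minimizing sequences are Cauchy: applied at a midpoint, strong convexity
  (\<open>ROF_energy_strongly_convex\<close>) bounds the distance of two almost minimizing functions. A
  minimizing sequence chosen with geometrically decreasing increments converges almost
  everywhere, and Fatou's lemma makes its limit \<open>u\<close> a minimizer (\<open>ROF_minimizer_exists\<close>). The total variation integrates
  against \<open>m x\<close> and \<open>\<nu>\<close>, so Fatou needs convergence \<open>m x\<close>-almost everywhere for almost every \<open>x\<close>;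
  this follows from convergence \<open>\<nu>\<close>-almost everywhere because reversibility makes \<open>\<nu>\<close> invariant
  (\<open>AE_walk\<close>).

  Second, the energy exceeds its minimum by at least \<open>lam/2 \<parallel>u - w\<parallel>\<^sup>2\<close>
  (\<open>ROF_energy_quadratic_growth\<close>). This gives uniqueness, and after expanding the squares it is
  the statement \<open>lam (f - u) \<in> \<partial>TV u\<close>. Along the flow, \<open>- (lam (v - f) + v') \<in> \<partial>TV v\<close> for almost every
  time. Adding the two subgradient inequalities, the total variations cancel and
  \<open>\<langle>v', v - u\<rangle> \<le> - lam \<parallel>v - u\<parallel>\<^sup>2\<close> remains (\<open>flow_dissipation\<close>).

  Formally this reads \<open>d/dt \<parallel>v - u\<parallel>\<^sup>2 \<le> - 2 lam \<parallel>v - u\<parallel>\<^sup>2\<close>, and Gronwall's lemma gives the claim. As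
  \<open>v\<close> is only a primitive of a Bochner integrable function, the chain rule is replaced by an
  estimate of increments: on a short interval \<open>\<parallel>v(b) - u\<parallel>\<^sup>2 - \<parallel>v(a) - u\<parallel>\<^sup>2\<close> is the integral of
  \<open>\<langle>v', (v(b) - u) + (v(a) - u)\<rangle>\<close>, in which the second factor is uniformly close to
  \<open>2 (v(r) - u)\<close>. The local errors are controlled by \<open>\<integral>\<parallel>v'\<parallel>\<close> and vanish in the limit
  (\<open>L2_norm_power2_increment_le\<close>).
\<close>

section \<open>Square-integrable functions\<close>

lemma L2_measurable: "u \<in> L2 M \<Longrightarrow> u \<in> borel_measurable M"
  by (simp add: L2_def)

lemma L2_square_integrable: "u \<in> L2 M \<Longrightarrow> integrable M (\<lambda>x. (u x)\<^sup>2)"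
  by (simp add: L2_def)

lemma L2_mult_integrable:
  assumes "u \<in> L2 M" "v \<in> L2 M"
  shows "integrable M (\<lambda>x. u x * v x)"
proof (rule Bochner_Integration.integrable_bound)
  show "integrable M (\<lambda>x. (u x)\<^sup>2 + (v x)\<^sup>2)"
    using assms by (auto simp: L2_def)
  show "(\<lambda>x. u x * v x) \<in> borel_measurable M"
    using assms by (auto simp: L2_def)
  have "\<bar>a * b\<bar> \<le> a\<^sup>2 + b\<^sup>2" for a b :: real
  proof -
    have "0 \<le> (\<bar>a\<bar> - \<bar>b\<bar>)\<^sup>2"
      by simp
    then have "2 * (\<bar>a\<bar> * \<bar>b\<bar>) \<le> a\<^sup>2 + b\<^sup>2"
      by (simp add: power2_diff)
    moreover have "0 \<le> \<bar>a\<bar> * \<bar>b\<bar>"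
      by simp
    ultimately show ?thesis
      unfolding abs_mult by linarith
  qed
  then show "AE x in M. norm (u x * v x) \<le> norm ((u x)\<^sup>2 + (v x)\<^sup>2)"
    by simp
qed

lemma L2_add:
  assumes "u \<in> L2 M" "v \<in> L2 M"
  shows "(\<lambda>x. u x + v x) \<in> L2 M"
proof -
  have "integrable M (\<lambda>x. (u x)\<^sup>2 + (v x)\<^sup>2 + 2 * (u x * v x))"
    using assms L2_mult_integrable[OF assms] by (auto simp: L2_def)
  then show ?thesis
    using assms by (auto simp: L2_def power2_sum mult.assoc)
qed

lemma L2_scale:
  assumes "u \<in> L2 M"
  shows "(\<lambda>x. c * u x) \<in> L2 M"
  using assms by (auto simp: L2_def power_mult_distrib)

lemma L2_diff:
  assumes "u \<in> L2 M" "v \<in> L2 M"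
  shows "(\<lambda>x. u x - v x) \<in> L2 M"
  using L2_add[OF assms(1) L2_scale[OF assms(2), of "-1"]] by simp

lemma L2_sum:
  assumes "\<And>i. i \<in> A \<Longrightarrow> u i \<in> L2 M"
  shows "(\<lambda>x. \<Sum>i\<in>A. u i x) \<in> L2 M"
  using assms
proof (induction A rule: infinite_finite_induct)
  case (insert i A)
  then show ?case
    using L2_add[of "u i" M "\<lambda>x. \<Sum>i\<in>A. u i x"] by simp
qed (simp_all add: L2_def)

lemma L2_norm_nonneg [simp]: "0 \<le> L2_norm M u"
  by (simp add: L2_norm_def)

lemma L2_norm_power2: "(L2_norm M u)\<^sup>2 = (\<integral>x. (u x)\<^sup>2 \<partial>M)"
  by (simp add: L2_norm_def)

lemma L2_norm_minus_commute: "L2_norm M (\<lambda>x. u x - v x) = L2_norm M (\<lambda>x. v x - u x)"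
  by (simp add: L2_norm_def power2_commute)

lemma L2_Cauchy_Schwarz:
  assumes "u \<in> L2 M" "v \<in> L2 M"
  shows "\<bar>\<integral>x. u x * v x \<partial>M\<bar> \<le> L2_norm M u * L2_norm M v"
proof -
  let ?p = "\<integral>x. u x * v x \<partial>M" and ?a = "\<integral>x. (u x)\<^sup>2 \<partial>M" and ?b = "\<integral>x. (v x)\<^sup>2 \<partial>M"
  note [simp] = L2_square_integrable[OF assms(1)] L2_square_integrable[OF assms(2)]
    L2_mult_integrable[OF assms]
  have quad: "0 \<le> r\<^sup>2 * ?a - 2 * r * q * ?p + q\<^sup>2 * ?b" for r q
  proof -
    have "0 \<le> (\<integral>x. (r * u x - q * v x)\<^sup>2 \<partial>M)"
      by simp
    also have "\<dots> = (\<integral>x. r\<^sup>2 * (u x)\<^sup>2 - 2 * r * q * (u x * v x) + q\<^sup>2 * (v x)\<^sup>2 \<partial>M)"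
      by (simp add: power2_diff power_mult_distrib algebra_simps)
    also have "\<dots> = r\<^sup>2 * ?a - 2 * r * q * ?p + q\<^sup>2 * ?b"
      by simp
    finally show ?thesis .
  qed
  have b: "0 \<le> ?b" by simp
  have "?p\<^sup>2 \<le> ?a * ?b"
  proof (cases "?b = 0")
    case True
    then have "0 \<le> ?a - 2 * q * ?p" for q
      using quad[of 1 q] by simp
    \<comment> \<open>if \<open>?p\<close> were nonzero, this choice of \<open>q\<close> would make the right-hand side \<open>-1\<close>\<close>
    from this[of "(?a + 1) / (2 * ?p)"] have "?p = 0"
      by (cases "?p = 0") (auto simp: field_simps)
    then show ?thesis using True by simp
  next
    case False
    with b have "0 < ?b" by linarith
    have "0 \<le> ?b * (?a * ?b - ?p\<^sup>2)"
      using quad[of ?b ?p] by (simp add: power2_eq_square algebra_simps)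
    with \<open>0 < ?b\<close> show ?thesis
      by (simp add: zero_le_mult_iff)
  qed
  then have "sqrt (?p\<^sup>2) \<le> sqrt (?a * ?b)"
    by (rule real_sqrt_le_mono)
  then show ?thesis
    by (simp add: L2_norm_def real_sqrt_mult)
qed

lemma L2_norm_power2_add:
  assumes "u \<in> L2 M" "v \<in> L2 M"
  shows "(L2_norm M (\<lambda>x. u x + v x))\<^sup>2 =
    (L2_norm M u)\<^sup>2 + 2 * (\<integral>x. u x * v x \<partial>M) + (L2_norm M v)\<^sup>2"
proof -
  have "(\<integral>x. (u x + v x)\<^sup>2 \<partial>M) = (\<integral>x. (u x)\<^sup>2 + 2 * (u x * v x) + (v x)\<^sup>2 \<partial>M)"
    by (simp add: power2_sum algebra_simps)
  then show ?thesis
    using assms L2_mult_integrable[OF assms] by (simp add: L2_norm_power2 L2_square_integrable)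
qed

lemma L2_norm_triangle:
  assumes "u \<in> L2 M" "v \<in> L2 M"
  shows "L2_norm M (\<lambda>x. u x + v x) \<le> L2_norm M u + L2_norm M v"
proof (rule power2_le_imp_le)
  show "(L2_norm M (\<lambda>x. u x + v x))\<^sup>2 \<le> (L2_norm M u + L2_norm M v)\<^sup>2"
    using L2_Cauchy_Schwarz[OF assms]
    by (simp add: L2_norm_power2_add[OF assms] power2_sum)
qed simp

lemma L2_dist_triangle:
  assumes "u \<in> L2 M" "v \<in> L2 M" "w \<in> L2 M"
  shows "L2_norm M (\<lambda>x. u x - w x) \<le> L2_norm M (\<lambda>x. u x - v x) + L2_norm M (\<lambda>x. v x - w x)"
  using L2_norm_triangle[OF L2_diff[OF assms(1,2)] L2_diff[OF assms(2,3)]] by simp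

lemma L2_norm_diff_le:
  assumes "u \<in> L2 M" "v \<in> L2 M"
  shows "\<bar>L2_norm M u - L2_norm M v\<bar> \<le> L2_norm M (\<lambda>x. u x - v x)"
  using L2_norm_triangle[OF assms(2) L2_diff[OF assms(1,2)]]
    L2_norm_triangle[OF assms(1) L2_diff[OF assms(2,1)]]
  by (simp add: L2_norm_minus_commute[of M v u])

lemma L2_norm_cong_AE:
  assumes "AE x in M. u x = v x" "u \<in> L2 M" "v \<in> L2 M"
  shows "L2_norm M u = L2_norm M v"
  unfolding L2_norm_def
  using assms by (intro arg_cong[where f=sqrt] integral_cong_AE) (auto simp: L2_def)

lemma (in finite_measure) L2_const: "(\<lambda>x. c) \<in> L2 M"
  by (simp add: L2_def)

lemma (in finite_measure) L1_le_L2: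
  assumes "d \<in> L2 M"
  shows "(\<integral>\<^sup>+x. ennreal \<bar>d x\<bar> \<partial>M) \<le> ennreal (L2_norm M d * L2_norm M (\<lambda>x. 1))"
proof -
  have abs: "(\<lambda>x. \<bar>d x\<bar>) \<in> L2 M"
    using assms by (auto simp: L2_def)
  have "integrable M (\<lambda>x. \<bar>d x\<bar>)"
    using L2_mult_integrable[OF abs L2_const[of 1]] by simp
  then have "(\<integral>\<^sup>+x. ennreal \<bar>d x\<bar> \<partial>M) = ennreal (\<integral>x. \<bar>d x\<bar> * 1 \<partial>M)"
    by (subst nn_integral_eq_integral) auto
  also have "\<dots> \<le> ennreal (L2_norm M (\<lambda>x. \<bar>d x\<bar>) * L2_norm M (\<lambda>x. 1))"
    using L2_Cauchy_Schwarz[OF abs L2_const[of 1]] by (intro ennreal_leI) linarith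
  finally show ?thesis
    by (simp add: L2_norm_def)
qed

text \<open>This replaces completeness of \<open>L\<^sup>2\<close> in the construction of the minimizer: the increments
  are summable in \<open>L\<^sup>1\<close>, so their absolute values have an integrable, hence almost everywhere
  finite, sum, and the telescoping series converges absolutely.\<close>

lemma (in finite_measure) AE_convergent_of_geometric_L2:
  assumes v: "\<And>n. v n \<in> L2 M"
    and geom: "\<And>n. L2_norm M (\<lambda>x. v (Suc n) x - v n x) \<le> C * (1 / 2) ^ n"
  shows "AE x in M. convergent (\<lambda>n. v n x)"
proof -
  define d where "d n x = v (Suc n) x - v n x" for n x
  have d: "d n \<in> L2 M" for n
    unfolding d_def by (intro L2_diff v)
  note [measurable] = L2_measurable[OF d]
  define K where "K = C * L2_norm M (\<lambda>x. 1)"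
  have le: "(\<integral>\<^sup>+x. ennreal \<bar>d n x\<bar> \<partial>M) \<le> ennreal (K * (1 / 2) ^ n)" for n
  proof -
    have "L2_norm M (d n) * L2_norm M (\<lambda>x. 1) \<le> (C * (1 / 2) ^ n) * L2_norm M (\<lambda>x. 1)"
      using geom[of n] unfolding d_def by (intro mult_right_mono) auto
    then show ?thesis
      using L1_le_L2[OF d[of n]] by (auto simp: K_def mult_ac intro: order_trans ennreal_leI)
  qed
  have "0 \<le> C"
    using order_trans[OF L2_norm_nonneg geom[of 0]] by simp
  then have K: "0 \<le> K"
    by (simp add: K_def)
  have "(\<integral>\<^sup>+x. (\<Sum>n. ennreal \<bar>d n x\<bar>) \<partial>M) = (\<Sum>n. \<integral>\<^sup>+x. ennreal \<bar>d n x\<bar> \<partial>M)"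
    by (rule nn_integral_suminf) measurable
  also have "\<dots> \<le> (\<Sum>n. ennreal (K * (1 / 2) ^ n))"
    by (intro suminf_le le) auto
  also have "\<dots> = ennreal (\<Sum>n. K * (1 / 2) ^ n)"
    using K by (intro suminf_ennreal2) (auto intro!: summable_mult summable_geometric)
  finally have "(\<integral>\<^sup>+x. (\<Sum>n. ennreal \<bar>d n x\<bar>) \<partial>M) \<noteq> \<infinity>"
    by (auto simp: top_unique)
  then have "AE x in M. (\<Sum>n. ennreal \<bar>d n x\<bar>) \<noteq> \<infinity>"
    by (intro nn_integral_PInf_AE) auto
  then show ?thesis
  proof eventually_elim
    case (elim x)
    then have "summable (\<lambda>n. \<bar>d n x\<bar>)"
      by (intro summable_suminf_not_top) auto
    then have "summable (\<lambda>n. d n x)"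
      by (rule summable_rabs_cancel)
    then have "(\<lambda>n. v 0 x + (\<Sum>k<n. d k x)) \<longlonglongrightarrow> v 0 x + (\<Sum>k. d k x)"
      by (intro tendsto_intros summable_LIMSEQ)
    moreover have "v 0 x + (\<Sum>k<n. d k x) = v n x" for n
      unfolding d_def by (subst sum_lessThan_telescope) simp
    ultimately show ?case
      by (auto simp: convergent_def)
  qed
qed

section \<open>Vector-valued integrals tested against a fixed function\<close>

text \<open>Strong measurability of \<open>w\<close> makes the error of each approximation measurable up to a null
  set, since it is the almost everywhere limit of distances between two simple functions.\<close>

lemma L2_norm_measurable_limit:
  assumes simple: "\<And>k. simple_function (lebesgue_on {a..b}) (s k)"
    and L2: "\<And>k t. t \<in> {a..b} \<Longrightarrow> s k t \<in> L2 M" "\<And>t. t \<in> {a..b} \<Longrightarrow> w t \<in> L2 M"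
    and lim: "AE t in lebesgue_on {a..b}. (\<lambda>k. L2_norm M (\<lambda>x. w t x - s k t x)) \<longlonglongrightarrow> 0"
  obtains D where "D \<in> borel_measurable (lebesgue_on {a..b})"
    "AE t in lebesgue_on {a..b}. L2_norm M (\<lambda>x. w t x - s n t x) = D t"
proof
  let ?d = "\<lambda>k t. L2_norm M (\<lambda>x. s k t x - s n t x)"
  have "simple_function (lebesgue_on {a..b}) (?d k)" for k
    using simple_function_compose2[OF simple[of k] simple[of n],
        of "\<lambda>y z. L2_norm M (\<lambda>x. y x - z x)"] by simp
  then have [measurable]: "?d k \<in> borel_measurable (lebesgue_on {a..b})" for k
    by (rule borel_measurable_simple_function)
  show "(\<lambda>t. lim (\<lambda>k. ?d k t)) \<in> borel_measurable (lebesgue_on {a..b})"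
    by measurable
  show "AE t in lebesgue_on {a..b}. L2_norm M (\<lambda>x. w t x - s n t x) = lim (\<lambda>k. ?d k t)"
    using lim AE_space
  proof eventually_elim
    case (elim t)
    then have t: "t \<in> {a..b}" by simp
    have "\<bar>?d k t - L2_norm M (\<lambda>x. w t x - s n t x)\<bar> \<le> L2_norm M (\<lambda>x. w t x - s k t x)" for k
      using L2_norm_diff_le[OF L2_diff[OF L2(1)[OF t] L2(1)[OF t]] L2_diff[OF L2(2)[OF t] L2(1)[OF t]],
          of k n n]
      by (simp add: L2_norm_minus_commute[of M "s k t"])
    then have "(\<lambda>k. ?d k t) \<longlonglongrightarrow> L2_norm M (\<lambda>x. w t x - s n t x)"
      using elim(1) by (intro Lim_transform_bound[OF _ elim(1), THEN LIM_zero_cancel]) auto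
    then show ?case
      by (simp add: limI)
  qed
qed

text \<open>The approximations of the definition, with measurable and integrable versions \<open>D n\<close> of
  the errors, so that the errors can be handled by Bochner integrals of real functions.\<close>

lemma has_L2_integralE:
  assumes "has_L2_integral M w a b I"
  obtains s D where
    "\<And>n. simple_function (lebesgue_on {a..b}) (s n)"
    "\<And>n t. t \<in> {a..b} \<Longrightarrow> s n t \<in> L2 M"
    "\<And>n. integrable (lebesgue_on {a..b}) (D n)"
    "\<And>n. AE t in lebesgue_on {a..b}. L2_norm M (\<lambda>x. w t x - s n t x) = D n t"
    "(\<lambda>n. integral\<^sup>L (lebesgue_on {a..b}) (D n)) \<longlonglongrightarrow> 0"
    "(\<lambda>n. L2_norm M (\<lambda>x. I x - L2_simple_integral a b (s n) x)) \<longlonglongrightarrow> 0"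
proof -
  let ?L = "lebesgue_on {a..b}"
  obtain s where s: "\<And>n::nat. simple_function ?L (s n)" "\<And>n t. t \<in> {a..b} \<Longrightarrow> s n t \<in> L2 M"
    and lim: "AE t in ?L. (\<lambda>n. L2_norm M (\<lambda>x. w t x - s n t x)) \<longlonglongrightarrow> 0"
    and mean: "(\<lambda>n. \<integral>\<^sup>+t. ennreal (L2_norm M (\<lambda>x. w t x - s n t x)) \<partial>?L) \<longlonglongrightarrow> 0"
    and int: "(\<lambda>n. L2_norm M (\<lambda>x. I x - L2_simple_integral a b (s n) x)) \<longlonglongrightarrow> 0"
    and w: "\<And>t. t \<in> {a..b} \<Longrightarrow> w t \<in> L2 M"
    using assms unfolding has_L2_integral_def by blast
  have "\<exists>D. D \<in> borel_measurable ?L \<and> (AE t in ?L. L2_norm M (\<lambda>x. w t x - s n t x) = D t)" for n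
    using L2_norm_measurable_limit[OF s w lim] by metis
  then have "\<exists>D. \<forall>n. D n \<in> borel_measurable ?L \<and> (AE t in ?L. L2_norm M (\<lambda>x. w t x - s n t x) = D n t)"
    by (intro choice allI)
  then obtain D where [measurable]: "\<And>n. D n \<in> borel_measurable ?L"
    and D: "\<And>n. AE t in ?L. L2_norm M (\<lambda>x. w t x - s n t x) = D n t"
    by blast
  have D0: "AE t in ?L. 0 \<le> D n t" for n
    using D[of n] by eventually_elim (metis L2_norm_nonneg)
  have eq: "(\<integral>\<^sup>+t. ennreal (L2_norm M (\<lambda>x. w t x - s n t x)) \<partial>?L) = (\<integral>\<^sup>+t. ennreal (D n t) \<partial>?L)" for n
    using D[of n] by (intro nn_integral_cong_AE) auto
  have "eventually (\<lambda>n. (\<integral>\<^sup>+t. ennreal (D n t) \<partial>?L) < 1) sequentially"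
    using mean unfolding eq by (rule order_tendstoD) simp
  \<comment> \<open>the first finitely many errors may have infinite integral and are discarded\<close>
  then obtain n0 where n0: "\<And>n. n \<ge> n0 \<Longrightarrow> (\<integral>\<^sup>+t. ennreal (D n t) \<partial>?L) < 1"
    by (auto simp: eventually_sequentially)
  have D_int: "integrable ?L (D (n + n0))" for n
    using D0[of "n + n0"] less_trans[OF n0[of "n + n0"] ennreal_one_less_top]
    by (intro integrableI_nonneg) auto
  have "(\<lambda>n. enn2real (\<integral>\<^sup>+t. ennreal (D n t) \<partial>?L)) \<longlonglongrightarrow> enn2real 0"
    using mean unfolding eq by (intro tendsto_enn2real) auto
  then have mean': "(\<lambda>n. integral\<^sup>L ?L (D n)) \<longlonglongrightarrow> 0"
    using D0 by (simp add: integral_eq_nn_integral)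
  show thesis
  proof (rule that[of "\<lambda>n. s (n + n0)" "\<lambda>n. D (n + n0)"])
    show "(\<lambda>n. integral\<^sup>L ?L (D (n + n0))) \<longlonglongrightarrow> 0"
      by (rule LIMSEQ_ignore_initial_segment[OF mean'])
    show "(\<lambda>n. L2_norm M (\<lambda>x. I x - L2_simple_integral a b (s (n + n0)) x)) \<longlonglongrightarrow> 0"
      by (rule LIMSEQ_ignore_initial_segment[OF int])
  qed (fact s(1) s(2) D_int D)+
qed

lemma has_L2_integral_norm_bound:
  assumes "has_L2_integral M w a b I"
  obtains N where "integrable (lebesgue_on {a..b}) N"
    "AE t in lebesgue_on {a..b}. L2_norm M (w t) \<le> N t"
proof -
  let ?L = "lebesgue_on {a..b}"
  have w: "\<And>t. t \<in> {a..b} \<Longrightarrow> w t \<in> L2 M"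
    using assms by (simp add: has_L2_integral_def)
  obtain s D where s: "\<And>n::nat. simple_function ?L (s n)" "\<And>n t. t \<in> {a..b} \<Longrightarrow> s n t \<in> L2 M"
    and D: "\<And>n. integrable ?L (D n)"
      "\<And>n. AE t in ?L. L2_norm M (\<lambda>x. w t x - s n t x) = D n t"
    by (rule has_L2_integralE[OF assms]) blast
  show thesis
  proof
    have simple: "simple_function ?L (\<lambda>t. L2_norm M (s 0 t))"
      using simple_function_compose1[OF s(1)[of 0], of "L2_norm M"] by simp
    have "integrable ?L (\<lambda>t. L2_norm M (s 0 t))"
    proof (rule integrable_simple_function)
      show "emeasure ?L {y \<in> space ?L. L2_norm M (s 0 y) \<noteq> 0} \<noteq> \<infinity>"
        using finite_measure.emeasure_finite[OF finite_measure_lebesgue_on[of "{a..b}"]]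
        by (simp add: top.not_eq_extremum)
    qed (fact simple)
    then show "integrable ?L (\<lambda>t. D 0 t + L2_norm M (s 0 t))"
      using D(1) by simp
    show "AE t in ?L. L2_norm M (w t) \<le> D 0 t + L2_norm M (s 0 t)"
      using D(2)[of 0] AE_space
    proof eventually_elim
      case (elim t)
      then have "t \<in> {a..b}" by simp
      then show ?case
        using L2_norm_triangle[OF L2_diff[OF w s(2)[of _ 0]] s(2)[of _ 0], of t t t] elim by simp
    qed
  qed
qed

lemma L2_simple_integral_L2:
  assumes "\<And>t. t \<in> {a..b} \<Longrightarrow> s t \<in> L2 M"
  shows "L2_simple_integral a b s \<in> L2 M"
  unfolding L2_simple_integral_def using assms by (intro L2_sum L2_scale) auto

lemma L2_simple_integral_inner:
  assumes s: "simple_function (lebesgue_on {a..b}) s" "\<And>t. t \<in> {a..b} \<Longrightarrow> s t \<in> L2 M"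
    and k: "k \<in> L2 M"
  shows "has_bochner_integral (lebesgue_on {a..b}) (\<lambda>t. \<integral>x. s t x * k x \<partial>M)
    (\<integral>x. L2_simple_integral a b s x * k x \<partial>M)"
proof -
  let ?L = "lebesgue_on {a..b}" and ?q = "\<lambda>y. \<integral>x. y x * k x \<partial>M"
  have fin: "finite (s ` {a..b})"
    using simple_functionD(1)[OF s(1)] by simp
  have meas: "{t\<in>{a..b}. s t = y} \<in> sets ?L" for y
    using simple_functionD(2)[OF s(1), of "{y}"] by (simp add: vimage_def Int_def conj_commute)
  have measure_eq: "measure ?L {t\<in>{a..b}. s t = y} = measure lebesgue {t\<in>{a..b}. s t = y}" for y
    by (rule measure_restrict_space) auto
  have sum: "has_bochner_integral ?L (\<lambda>t. \<Sum>y\<in>s ` {a..b}. indicator {t\<in>{a..b}. s t = y} t *\<^sub>R ?q y)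
      (\<Sum>y\<in>s ` {a..b}. measure ?L {t\<in>{a..b}. s t = y} *\<^sub>R ?q y)"
    using meas finite_measure.emeasure_finite[OF finite_measure_lebesgue_on[of "{a..b}"]]
    by (intro has_bochner_integral_sum has_bochner_integral_indicator) (auto simp: top.not_eq_extremum)
  have value_eq: "(\<Sum>y\<in>s ` {a..b}. measure ?L {t\<in>{a..b}. s t = y} *\<^sub>R ?q y) =
      (\<integral>x. L2_simple_integral a b s x * k x \<partial>M)"
  proof -
    have "(\<integral>x. L2_simple_integral a b s x * k x \<partial>M) =
        (\<integral>x. (\<Sum>y\<in>s ` {a..b}. measure lebesgue {t\<in>{a..b}. s t = y} * (y x * k x)) \<partial>M)"
      by (simp add: L2_simple_integral_def sum_distrib_right mult.assoc)
    also have "\<dots> = (\<Sum>y\<in>s ` {a..b}. measure lebesgue {t\<in>{a..b}. s t = y} * ?q y)"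
      using s(2) k by (subst Bochner_Integration.integral_sum)
        (auto intro!: integrable_mult_right L2_mult_integrable)
    finally show ?thesis
      by (simp only: measure_eq real_scaleR_def)
  qed
  have "(\<Sum>y\<in>s ` {a..b}. indicator {t\<in>{a..b}. s t = y} t *\<^sub>R ?q y) = ?q (s t)"
    if "t \<in> space ?L" for t
  proof -
    have "(\<Sum>y\<in>s ` {a..b}. indicator {t\<in>{a..b}. s t = y} t *\<^sub>R ?q y) =
        (\<Sum>y\<in>s ` {a..b}. if y = s t then ?q y else 0)"
      using that by (intro sum.cong) (auto simp: indicator_def)
    also have "\<dots> = ?q (s t)"
      using fin that by simp
    finally show ?thesis .
  qed
  then have "has_bochner_integral ?L (\<lambda>t. \<Sum>y\<in>s ` {a..b}. indicator {t\<in>{a..b}. s t = y} t *\<^sub>R ?q y) I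
      \<longleftrightarrow> has_bochner_integral ?L (\<lambda>t. ?q (s t)) I" for I
    by (rule has_bochner_integral_cong[OF refl _ refl])
  then show ?thesis
    using sum unfolding value_eq by (rule iffD1)
qed

text \<open>How the integral \<open>I\<close> of \<open>w\<close> enters the energy estimate: a bound for the scalar functions
  \<open>\<langle>w t, k\<rangle>\<close> integrates to a bound for \<open>\<langle>I, k\<rangle>\<close>. For simple functions testing commutes with
  integration, and by Cauchy-Schwarz the errors in the integrand and in the integral are at most
  \<open>\<parallel>k\<parallel>\<close> times quantities that tend to zero.\<close>

lemma has_L2_integral_inner_le:
  assumes I: "has_L2_integral M w a b I" and k: "k \<in> L2 M"
    and \<beta>: "integrable (lebesgue_on {a..b}) \<beta>"
    and le: "AE t in lebesgue_on {a..b}. (\<integral>x. w t x * k x \<partial>M) \<le> \<beta> t"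
  shows "(\<integral>x. I x * k x \<partial>M) \<le> integral\<^sup>L (lebesgue_on {a..b}) \<beta>"
proof -
  let ?L = "lebesgue_on {a..b}"
  have w: "\<And>t. t \<in> {a..b} \<Longrightarrow> w t \<in> L2 M" and IL2: "I \<in> L2 M"
    using I by (simp_all add: has_L2_integral_def)
  obtain s D where s: "\<And>n::nat. simple_function ?L (s n)" "\<And>n t. t \<in> {a..b} \<Longrightarrow> s n t \<in> L2 M"
    and D: "\<And>n. integrable ?L (D n)"
      "\<And>n. AE t in ?L. L2_norm M (\<lambda>x. w t x - s n t x) = D n t"
      "(\<lambda>n. integral\<^sup>L ?L (D n)) \<longlonglongrightarrow> 0"
    and lim: "(\<lambda>n. L2_norm M (\<lambda>x. I x - L2_simple_integral a b (s n) x)) \<longlonglongrightarrow> 0"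
    by (rule has_L2_integralE[OF I]) blast
  define J where "J n = L2_simple_integral a b (s n)" for n
  have J: "J n \<in> L2 M" for n
    unfolding J_def by (rule L2_simple_integral_L2) (rule s(2))
  have le_n: "(\<integral>x. J n x * k x \<partial>M) \<le> integral\<^sup>L ?L \<beta> + L2_norm M k * integral\<^sup>L ?L (D n)" for n
  proof -
    have "has_bochner_integral ?L (\<lambda>t. \<integral>x. s n t x * k x \<partial>M) (\<integral>x. J n x * k x \<partial>M)"
      unfolding J_def by (rule L2_simple_integral_inner[OF s k])
    then have q: "integrable ?L (\<lambda>t. \<integral>x. s n t x * k x \<partial>M)"
      "(\<integral>x. J n x * k x \<partial>M) = (\<integral>t. (\<integral>x. s n t x * k x \<partial>M) \<partial>?L)"
      by (auto simp: has_bochner_integral_iff)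
    have "AE t in ?L. (\<integral>x. s n t x * k x \<partial>M) \<le> \<beta> t + L2_norm M k * D n t"
      using le D(2)[of n] AE_space
    proof eventually_elim
      case (elim t)
      then have t: "t \<in> {a..b}" by simp
      have "\<bar>\<integral>x. (w t x - s n t x) * k x \<partial>M\<bar> \<le> D n t * L2_norm M k"
        using L2_Cauchy_Schwarz[OF L2_diff[OF w[OF t] s(2)[OF t]] k, of n] elim by simp
      moreover have "(\<integral>x. (w t x - s n t x) * k x \<partial>M) =
          (\<integral>x. w t x * k x \<partial>M) - (\<integral>x. s n t x * k x \<partial>M)"
        using L2_mult_integrable[OF w[OF t] k] L2_mult_integrable[OF s(2)[OF t] k]
        by (simp add: left_diff_distrib)
      ultimately show ?case
        using elim(1) by (simp add: mult.commute)
    qed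
    then have "(\<integral>t. (\<integral>x. s n t x * k x \<partial>M) \<partial>?L) \<le> (\<integral>t. \<beta> t + L2_norm M k * D n t \<partial>?L)"
      using q(1) \<beta> D(1)[of n] by (intro integral_mono_AE) auto
    then show ?thesis
      using \<beta> D(1)[of n] q(2) by simp
  qed
  have upper: "(\<lambda>n. integral\<^sup>L ?L \<beta> + L2_norm M k * integral\<^sup>L ?L (D n)) \<longlonglongrightarrow>
      integral\<^sup>L ?L \<beta> + L2_norm M k * 0"
    by (intro tendsto_intros D(3))
  have "(\<lambda>n. \<integral>x. J n x * k x \<partial>M) \<longlonglongrightarrow> (\<integral>x. I x * k x \<partial>M)"
  proof (rule LIM_zero_cancel, rule Lim_null_comparison)
    show "(\<lambda>n. L2_norm M (\<lambda>x. I x - J n x) * L2_norm M k) \<longlonglongrightarrow> 0"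
      using tendsto_mult_left_zero[OF lim, of "L2_norm M k"] unfolding J_def by simp
    have "\<bar>(\<integral>x. J n x * k x \<partial>M) - (\<integral>x. I x * k x \<partial>M)\<bar> \<le> L2_norm M (\<lambda>x. I x - J n x) * L2_norm M k" for n
      using L2_Cauchy_Schwarz[OF L2_diff[OF IL2 J[of n]] k] L2_mult_integrable[OF IL2 k]
        L2_mult_integrable[OF J[of n] k]
      by (simp add: left_diff_distrib abs_minus_commute)
    then show "\<forall>\<^sub>F n in sequentially. norm ((\<integral>x. J n x * k x \<partial>M) - (\<integral>x. I x * k x \<partial>M))
        \<le> L2_norm M (\<lambda>x. I x - J n x) * L2_norm M k"
      by simp
  qed
  from LIMSEQ_le[OF this upper] le_n show ?thesis
    by auto
qed


section \<open>Decay of the distance along an evolution\<close>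

lemma L2_norm_power2_difference:
  assumes "p \<in> L2 M" "q \<in> L2 M"
  shows "(L2_norm M p)\<^sup>2 - (L2_norm M q)\<^sup>2 = (\<integral>x. (p x - q x) * (p x + q x) \<partial>M)"
proof -
  have "(\<integral>x. (p x - q x) * (p x + q x) \<partial>M) = (\<integral>x. (p x)\<^sup>2 - (q x)\<^sup>2 \<partial>M)"
    by (simp add: power2_eq_square algebra_simps)
  then show ?thesis
    using assms by (simp add: L2_norm_power2 L2_square_integrable)
qed

lemma AE_lebesgue_on_Icc_subset:
  fixes a b s t :: real
  assumes "AE r in lebesgue_on {s..t}. P r" "s \<le> a" "b \<le> t"
  shows "AE r in lebesgue_on {a..b}. P r"
proof -
  have "AE r in lebesgue. r \<in> {s..t} \<longrightarrow> P r"
    using assms(1) by (simp add: AE_restrict_space_iff)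
  then have "AE r in lebesgue. r \<in> {a..b} \<longrightarrow> P r"
    by eventually_elim (use assms(2,3) in auto)
  then show ?thesis
    by (simp add: AE_restrict_space_iff)
qed

text \<open>An integrated chain rule for \<open>\<parallel>v - u\<parallel>\<^sup>2\<close>. The increment over \<open>[a, b]\<close> is
  \<open>\<langle>v b - v a, (v b - u) + (v a - u)\<rangle>\<close>, the integral of \<open>\<langle>w r, (v b - u) + (v a - u)\<rangle>\<close>. If \<open>v\<close> oscillates
  by at most \<open>\<epsilon> / 2\<close> on \<open>[a, b]\<close>, replacing the second factor by \<open>2 (v r - u)\<close> costs at most \<open>\<epsilon> \<parallel>w r\<parallel>\<close>.
  The resulting estimate is additive over adjacent intervals, so that the bisection principle
  extends it from short intervals to \<open>[s, t]\<close>; then \<open>\<epsilon>\<close> tends to zero.\<close>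

lemma L2_norm_power2_increment_le:
  assumes v: "L2_continuous_on M {s..t} v"
    and w: "\<And>a b. s \<le> a \<Longrightarrow> a \<le> b \<Longrightarrow> b \<le> t \<Longrightarrow> has_L2_integral M w a b (\<lambda>x. v b x - v a x)"
    and u: "u \<in> L2 M"
    and st: "s \<le> t"
    and K: "AE r in lebesgue_on {s..t}. (\<integral>x. w r x * (v r x - u x) \<partial>M) \<le> K"
  shows "(L2_norm M (\<lambda>x. v t x - u x))\<^sup>2 - (L2_norm M (\<lambda>x. v s x - u x))\<^sup>2 \<le> 2 * K * (t - s)"
proof -
  let ?\<phi> = "\<lambda>r. (L2_norm M (\<lambda>x. v r x - u x))\<^sup>2"
  have vL2: "\<And>r. r \<in> {s..t} \<Longrightarrow> v r \<in> L2 M"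
    using v by (simp add: L2_continuous_on_def)
  have wL2: "\<And>r. r \<in> {s..t} \<Longrightarrow> w r \<in> L2 M"
    using w[of s t] st by (simp add: has_L2_integral_def)
  obtain N where N: "integrable (lebesgue_on {s..t}) N"
    and wN: "AE r in lebesgue_on {s..t}. L2_norm M (w r) \<le> N r"
    using has_L2_integral_norm_bound[OF w[of s t]] st by auto
  define F where "F r = integral {s..r} N" for r
  have N_sub: "integrable (lebesgue_on {a..b}) N" if "s \<le> a" "b \<le> t" for a b
    using N by (rule integrable_subinterval) (use that in auto)
  have F: "integral\<^sup>L (lebesgue_on {a..b}) N = F b - F a" if "s \<le> a" "a \<le> b" "b \<le> t" for a b
  proof -
    have "N integrable_on {s..b}"
      using N_sub[of s b] that by (intro integrable_on_lebesgue_on) auto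
    then show ?thesis
      using Henstock_Kurzweil_Integration.integral_combine[of s a b N] that N_sub[of a b]
      by (simp add: F_def lebesgue_integral_eq_integral)
  qed
  have main: "?\<phi> t - ?\<phi> s \<le> 2 * K * (t - s) + \<epsilon> * (F t - F s)" if "\<epsilon> > 0" for \<epsilon>
  proof -
    define P where "P a b \<longleftrightarrow> (s \<le> a \<and> a \<le> b \<and> b \<le> t \<longrightarrow>
        ?\<phi> b - ?\<phi> a \<le> 2 * K * (b - a) + \<epsilon> * (F b - F a))" for a b
    have "P s t"
      using st
    proof (induction rule: Bolzano)
      case (trans a b c)
      show ?case
        unfolding P_def
      proof
        assume "s \<le> a \<and> a \<le> c \<and> c \<le> t"
        with trans have "?\<phi> b - ?\<phi> a \<le> 2 * K * (b - a) + \<epsilon> * (F b - F a)"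
          "?\<phi> c - ?\<phi> b \<le> 2 * K * (c - b) + \<epsilon> * (F c - F b)"
          by (auto simp: P_def)
        then show "?\<phi> c - ?\<phi> a \<le> 2 * K * (c - a) + \<epsilon> * (F c - F a)"
          by (simp add: algebra_simps)
      qed
    next
      case (local x)
      have "((\<lambda>r. L2_norm M (\<lambda>y. v r y - v x y)) \<longlongrightarrow> 0) (at x within {s..t})"
        using v local by (simp add: L2_continuous_on_def)
      then have "eventually (\<lambda>r. L2_norm M (\<lambda>y. v r y - v x y) < \<epsilon> / 4) (at x within {s..t})"
        by (rule order_tendstoD) (use \<open>\<epsilon> > 0\<close> in simp)
      then obtain d where "d > 0" and d: "\<And>r. r \<in> {s..t} \<Longrightarrow> r \<noteq> x \<Longrightarrow> dist r x < d \<Longrightarrow>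
          L2_norm M (\<lambda>y. v r y - v x y) < \<epsilon> / 4"
        by (auto simp: eventually_at)
      have close: "L2_norm M (\<lambda>y. v r y - v x y) \<le> \<epsilon> / 4" if "r \<in> {s..t}" "\<bar>r - x\<bar> < d" for r
        using d[of r] that \<open>\<epsilon> > 0\<close> by (cases "r = x") (auto simp: dist_real_def L2_norm_def)
      show ?case
      proof (intro exI[of _ d] conjI allI impI)
        fix a b assume ab: "a \<le> x \<and> x \<le> b \<and> b - a < d"
        show "P a b"
          unfolding P_def
        proof
          assume "s \<le> a \<and> a \<le> b \<and> b \<le> t"
          then have *: "s \<le> a" "a \<le> b" "b \<le> t" by simp_all
          define p q where "p = (\<lambda>y. v b y - u y)" and "q = (\<lambda>y. v a y - u y)"
          have pq: "p \<in> L2 M" "q \<in> L2 M"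
            unfolding p_def q_def using * u vL2 by (auto intro!: L2_diff)
          have AE_K: "AE r in lebesgue_on {a..b}. (\<integral>y. w r y * (v r y - u y) \<partial>M) \<le> K"
            and AE_N: "AE r in lebesgue_on {a..b}. L2_norm M (w r) \<le> N r"
            using AE_lebesgue_on_Icc_subset[OF K *(1,3)] AE_lebesgue_on_Icc_subset[OF wN *(1,3)] .
          have "AE r in lebesgue_on {a..b}. (\<integral>y. w r y * (p y + q y) \<partial>M) \<le> 2 * K + \<epsilon> * N r"
            using AE_K AE_N AE_space
          proof eventually_elim
            case (elim r)
            then have r: "r \<in> {s..t}" "r \<in> {a..b}" using * by auto
            have rx: "\<bar>r - x\<bar> < d" using r ab by auto
            have ab': "a \<in> {s..t}" "b \<in> {s..t}" "x \<in> {s..t}" using * ab by auto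
            define g where "g = (\<lambda>y. (v b y - v r y) + (v a y - v r y))"
            have g: "g \<in> L2 M"
              unfolding g_def using ab' r vL2 by (intro L2_add L2_diff) auto
            have "L2_norm M (\<lambda>y. v c y - v r y) \<le> \<epsilon> / 2" if "c \<in> {s..t}" "\<bar>c - x\<bar> < d" for c
              using L2_dist_triangle[OF vL2[OF that(1)] vL2[OF ab'(3)] vL2[OF r(1)]]
                close[OF that] close[OF r(1) rx]
              by (auto simp: L2_norm_minus_commute[of M "v x" "v r"])
            from this[of a] this[of b] have "L2_norm M g \<le> \<epsilon>"
              using L2_norm_triangle[OF L2_diff[OF vL2[OF ab'(2)] vL2[OF r(1)]] L2_diff[OF vL2[OF ab'(1)] vL2[OF r(1)]]]
                ab ab' by (simp add: g_def)
            then have "L2_norm M (w r) * L2_norm M g \<le> N r * \<epsilon>"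
              using elim by (intro mult_mono) (auto intro: order_trans[OF L2_norm_nonneg])
            then have "(\<integral>y. w r y * g y \<partial>M) \<le> \<epsilon> * N r"
              using L2_Cauchy_Schwarz[OF wL2[OF r(1)] g] by (simp add: mult.commute)
            moreover have "(\<integral>y. w r y * (p y + q y) \<partial>M) =
                (\<integral>y. 2 * (w r y * (v r y - u y)) + w r y * g y \<partial>M)"
              by (simp add: p_def q_def g_def algebra_simps)
            moreover have "\<dots> = 2 * (\<integral>y. w r y * (v r y - u y) \<partial>M) + (\<integral>y. w r y * g y \<partial>M)"
              using L2_mult_integrable[OF wL2[OF r(1)] L2_diff[OF vL2[OF r(1)] u]]
                L2_mult_integrable[OF wL2[OF r(1)] g] by simp
            ultimately show ?case
              using elim by simp
          qed
          then have "(\<integral>y. (v b y - v a y) * (p y + q y) \<partial>M) \<le>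
              (\<integral>r. 2 * K + \<epsilon> * N r \<partial>lebesgue_on {a..b})"
            using N_sub[OF *(1,3)] *
            by (intro has_L2_integral_inner_le[OF w[OF *] L2_add[OF pq]]) auto
          also have "\<dots> = 2 * K * (b - a) + \<epsilon> * (F b - F a)"
            using N_sub[OF *(1,3)] F[OF *] * by (simp add: measure_restrict_space)
          finally show "?\<phi> b - ?\<phi> a \<le> 2 * K * (b - a) + \<epsilon> * (F b - F a)"
            using L2_norm_power2_difference[OF pq] by (simp add: p_def q_def)
        qed
      qed (fact \<open>d > 0\<close>)
    qed
    then show ?thesis
      using st by (simp add: P_def)
  qed
  have "((\<lambda>\<epsilon>. 2 * K * (t - s) + \<epsilon> * (F t - F s)) \<longlongrightarrow> 2 * K * (t - s) + 0 * (F t - F s)) (at_right 0)"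
    by (intro tendsto_intros)
  then have "?\<phi> t - ?\<phi> s \<le> 2 * K * (t - s) + 0 * (F t - F s)"
    by (rule tendsto_lowerbound) (auto simp: eventually_at_right_less main intro!: eventually_mono[OF eventually_at_right_less])
  then show ?thesis by simp
qed

text \<open>Gronwall's lemma from one-sided bounds of increments. The choice \<open>c = 0\<close> shows that \<open>\<phi>\<close>
  decreases, so \<open>c = \<phi> b\<close> is admissible on \<open>[a, b]\<close> and yields the implicit Euler estimate
  \<open>\<phi> b (1 + \<kappa> (b - a)) \<le> \<phi> a\<close>. Iterating it over \<open>n\<close> equal steps gives the exponential in the limit.\<close>

lemma exp_decayI:
  fixes \<phi> :: "real \<Rightarrow> real"
  assumes step: "\<And>a b c. s \<le> a \<Longrightarrow> a \<le> b \<Longrightarrow> b \<le> t \<Longrightarrow> (\<And>r. r \<in> {a..b} \<Longrightarrow> c \<le> \<phi> r) \<Longrightarrow>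
      \<phi> b - \<phi> a \<le> - \<kappa> * c * (b - a)"
    and nonneg: "\<And>r. 0 \<le> \<phi> r" and "0 \<le> \<kappa>" and st: "s \<le> t"
  shows "\<phi> t \<le> \<phi> s * exp (- \<kappa> * (t - s))"
proof -
  have mono: "\<phi> b \<le> \<phi> a" if "s \<le> a" "a \<le> b" "b \<le> t" for a b
    using step[OF that, of 0] nonneg by simp
  have decr: "\<phi> b * (1 + \<kappa> * (b - a)) \<le> \<phi> a" if "s \<le> a" "a \<le> b" "b \<le> t" for a b
    using step[OF that, of "\<phi> b"] mono that by (force simp: algebra_simps)
  have "\<phi> t * (1 + \<kappa> * (t - s) / real n) ^ n \<le> \<phi> s" if "n > 0" for n
  proof -
    define h where "h = (t - s) / real n"
    have h: "0 \<le> h" "real n * h = t - s"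
      using that st by (auto simp: h_def)
    have "\<phi> (s + real i * h) * (1 + \<kappa> * h) ^ i \<le> \<phi> s" if "i \<le> n" for i
      using that
    proof (induction i)
      case (Suc i)
      have "real (Suc i) * h \<le> real n * h"
        using Suc.prems h by (intro mult_right_mono) auto
      then have "\<phi> (s + real (Suc i) * h) * (1 + \<kappa> * h) \<le> \<phi> (s + real i * h)"
        using decr[of "s + real i * h" "s + real (Suc i) * h"] h by (simp add: algebra_simps)
      then have "\<phi> (s + real (Suc i) * h) * (1 + \<kappa> * h) * (1 + \<kappa> * h) ^ i
          \<le> \<phi> (s + real i * h) * (1 + \<kappa> * h) ^ i"
        using h \<open>0 \<le> \<kappa>\<close> by (intro mult_right_mono) auto
      also have "\<dots> \<le> \<phi> s"
        using Suc by simp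
      finally show ?case
        by (simp add: mult.assoc)
    qed simp
    from this[of n] show ?thesis
      using h by (simp add: h_def)
  qed
  then have "eventually (\<lambda>n. \<phi> t * (1 + \<kappa> * (t - s) / real n) ^ n \<le> \<phi> s) sequentially"
    by (auto intro: eventually_mono[OF eventually_gt_at_top[of 0]])
  moreover have "(\<lambda>n. \<phi> t * (1 + \<kappa> * (t - s) / real n) ^ n) \<longlonglongrightarrow> \<phi> t * exp (\<kappa> * (t - s))"
    by (intro tendsto_intros tendsto_exp_limit_sequentially)
  ultimately have "\<phi> t * exp (\<kappa> * (t - s)) \<le> \<phi> s"
    by (intro tendsto_upperbound[where F=sequentially]) auto
  then have "\<phi> t * exp (\<kappa> * (t - s)) * exp (- \<kappa> * (t - s)) \<le> \<phi> s * exp (- \<kappa> * (t - s))"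
    by (rule mult_right_mono) simp
  then show ?thesis
    by (simp add: mult.assoc flip: exp_add)
qed

text \<open>The weak derivative lives on the open interval, so the decay is first obtained from an
  initial time \<open>s > 0\<close>; continuity at \<open>0\<close> then allows \<open>s\<close> to tend to \<open>0\<close>.\<close>

lemma L2_exp_decay:
  assumes cont: "L2_continuous_on M {0..T} v"
    and deriv: "W11_loc_deriv M 0 T v w"
    and u: "u \<in> L2 M" and "0 \<le> \<kappa>"
    and diss: "AE r in lebesgue_on {0<..<T}.
      (\<integral>x. w r x * (v r x - u x) \<partial>M) \<le> - \<kappa> * (L2_norm M (\<lambda>x. v r x - u x))\<^sup>2"
    and t: "0 \<le> t" "t < T"
  shows "L2_norm M (\<lambda>x. v t x - u x) \<le> L2_norm M (\<lambda>x. v 0 x - u x) * exp (- \<kappa> * t)"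
proof (cases "t = 0")
  case False
  with t have "0 < t" by simp
  let ?\<phi> = "\<lambda>r. L2_norm M (\<lambda>x. v r x - u x)"
  have vL2: "\<And>r. r \<in> {0..T} \<Longrightarrow> v r \<in> L2 M"
    using cont by (simp add: L2_continuous_on_def)
  have step: "(?\<phi> b)\<^sup>2 - (?\<phi> a)\<^sup>2 \<le> - (2 * \<kappa>) * c * (b - a)"
    if ab: "0 < a" "a \<le> b" "b < T" and c: "\<And>r. r \<in> {a..b} \<Longrightarrow> c \<le> (?\<phi> r)\<^sup>2" for a b c
  proof -
    have "AE r in lebesgue_on {a..b}. (\<integral>x. w r x * (v r x - u x) \<partial>M) \<le> - \<kappa> * (?\<phi> r)\<^sup>2"
      using diss ab by (auto simp: AE_restrict_space_iff elim!: eventually_mono)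
    then have "AE r in lebesgue_on {a..b}. (\<integral>x. w r x * (v r x - u x) \<partial>M) \<le> - \<kappa> * c"
      using AE_space
    proof eventually_elim
      case (elim r)
      then have "\<kappa> * c \<le> \<kappa> * (?\<phi> r)\<^sup>2"
        using c[of r] \<open>0 \<le> \<kappa>\<close> by (intro mult_left_mono) auto
      with elim show ?case by simp
    qed
    moreover have "L2_continuous_on M {a..b} v"
      using cont ab unfolding L2_continuous_on_def
      by (auto intro!: tendsto_within_subset[of _ _ _ "{0..T}" "{a..b}"])
    moreover have "\<And>c d. a \<le> c \<Longrightarrow> c \<le> d \<Longrightarrow> d \<le> b \<Longrightarrow> has_L2_integral M w c d (\<lambda>x. v d x - v c x)"
      using deriv ab by (simp add: W11_loc_deriv_def)
    ultimately show ?thesis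
      using L2_norm_power2_increment_le[of M a b v w u "- \<kappa> * c"] ab u by simp
  qed
  have "?\<phi> t \<le> ?\<phi> s * exp (- \<kappa> * (t - s))" if s: "0 < s" "s \<le> t" for s
  proof (rule power2_le_imp_le)
    have "(?\<phi> t)\<^sup>2 \<le> (?\<phi> s)\<^sup>2 * exp (- (2 * \<kappa>) * (t - s))"
      by (rule exp_decayI[where \<phi>="\<lambda>r. (?\<phi> r)\<^sup>2"]) (use step s t \<open>0 \<le> \<kappa>\<close> in auto)
    also have "\<dots> = (?\<phi> s * exp (- \<kappa> * (t - s)))\<^sup>2"
      by (simp add: power_mult_distrib exp_double[symmetric] algebra_simps)
    finally show "(?\<phi> t)\<^sup>2 \<le> (?\<phi> s * exp (- \<kappa> * (t - s)))\<^sup>2" .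
  qed simp
  then have "eventually (\<lambda>s. ?\<phi> t \<le> ?\<phi> s * exp (- \<kappa> * (t - s))) (at_right 0)"
    using \<open>0 < t\<close> by (auto simp: eventually_at_right_field intro!: exI[of _ t])
  moreover have "((\<lambda>s. ?\<phi> s * exp (- \<kappa> * (t - s))) \<longlongrightarrow> ?\<phi> 0 * exp (- \<kappa> * (t - 0))) (at_right 0)"
  proof (intro tendsto_intros)
    have "((\<lambda>s. L2_norm M (\<lambda>x. v s x - v 0 x)) \<longlongrightarrow> 0) (at 0 within {0..T})"
      using cont t by (simp add: L2_continuous_on_def)
    then have lim: "((\<lambda>s. L2_norm M (\<lambda>x. v s x - v 0 x)) \<longlongrightarrow> 0) (at_right 0)"
      using \<open>0 < t\<close> t by (simp add: at_within_Icc_at_right)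
    have "eventually (\<lambda>s. norm (?\<phi> s - ?\<phi> 0) \<le> L2_norm M (\<lambda>x. v s x - v 0 x)) (at_right 0)"
    proof -
      have "norm (?\<phi> s - ?\<phi> 0) \<le> L2_norm M (\<lambda>x. v s x - v 0 x)" if "0 < s" "s < T" for s
        using L2_norm_diff_le[OF L2_diff[OF vL2 u] L2_diff[OF vL2 u], of s 0] that by simp
      then show ?thesis
        using \<open>0 < t\<close> t by (auto simp: eventually_at_right_field intro!: exI[of _ T])
    qed
    then have "((\<lambda>s. ?\<phi> s - ?\<phi> 0) \<longlongrightarrow> 0) (at_right 0)"
      using lim by (rule Lim_null_comparison)
    then show "(?\<phi> \<longlongrightarrow> ?\<phi> 0) (at_right 0)"
      by (rule LIM_zero_cancel)
  qed
  ultimately show ?thesis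
    by (intro tendsto_lowerbound[where F="at_right 0"]) auto
qed simp


section \<open>Invariance of the reference measure\<close>

locale reversible_walk =
  fixes m :: "'a::polish_space \<Rightarrow> 'a measure" and \<nu> :: "'a measure"
  assumes walk: "random_walk m"
    and sets_nu [measurable_cong]: "sets \<nu> = sets borel"
    and finite_nu: "finite_measure \<nu>"
    and reversible: "reversible m \<nu>"
begin

sublocale finite_measure \<nu>
  by (rule finite_nu)

lemma space_nu [simp]: "space \<nu> = UNIV"
  using sets_eq_imp_space_eq[OF sets_nu] by simp

lemma sets_walk [measurable_cong]: "sets (m x) = sets borel"
  using walk by (simp add: random_walk_def)

lemma space_walk [simp]: "space (m x) = UNIV"
  using sets_eq_imp_space_eq[OF sets_walk] by simp

lemma emeasure_walk_UNIV [simp]: "emeasure (m x) UNIV = 1"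
  using walk prob_space.emeasure_space_1[of "m x"] by (simp add: random_walk_def)

lemma walk_kernel [measurable]: "m \<in> measurable \<nu> (subprob_algebra borel)"
proof (rule measurable_subprob_algebra)
  fix A :: "'a set" assume A: "A \<in> sets borel"
  have "(\<lambda>x. ennreal (measure (m x) A)) \<in> borel_measurable borel"
    using walk A by (auto simp: random_walk_def)
  moreover have "emeasure (m x) A = ennreal (measure (m x) A)" for x
    using walk finite_measure.emeasure_eq_measure[of "m x" A]
    by (simp add: random_walk_def prob_space_def)
  ultimately show "(\<lambda>x. emeasure (m x) A) \<in> borel_measurable \<nu>"
    by (simp add: measurable_cong_sets[OF sets_nu refl])
qed (use walk in \<open>auto simp: random_walk_def intro: prob_space_imp_subprob_space\<close>)

text \<open>Invariance of \<open>\<nu>\<close> is reversibility on the strip \<open>UNIV \<times> A\<close>: one step of the walk ends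
  in \<open>A\<close> with the same mass with which it starts there.\<close>

lemma bind_walk: "\<nu> \<bind> m = \<nu>"
proof (rule measure_eqI)
  show sets_eq: "sets (\<nu> \<bind> m) = sets \<nu>"
    by (subst sets_bind[where N=borel]) (simp_all add: sets_nu sets_walk)
  fix A assume "A \<in> sets (\<nu> \<bind> m)"
  then have A [measurable]: "A \<in> sets borel"
    using sets_eq sets_nu by simp
  have "(UNIV :: 'a set) \<times> A \<in> sets (borel \<Otimes>\<^sub>M borel)"
    using A by (intro pair_measureI) auto
  then have "(UNIV :: 'a set) \<times> A \<in> sets (borel :: ('a \<times> 'a) measure)"
    unfolding borel_prod .
  then have "(\<integral>\<^sup>+x. (\<integral>\<^sup>+y. indicator (UNIV \<times> A) (x, y) \<partial>m x) \<partial>\<nu>) =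
      (\<integral>\<^sup>+y. (\<integral>\<^sup>+x. indicator (UNIV \<times> A) (x, y) \<partial>m y) \<partial>\<nu>)"
    using reversible unfolding reversible_def by blast
  then have "(\<integral>\<^sup>+x. (\<integral>\<^sup>+y. indicator A y \<partial>m x) \<partial>\<nu>) = (\<integral>\<^sup>+y. indicator A y \<partial>\<nu>)"
    by (simp add: indicator_times)
  then show "emeasure (\<nu> \<bind> m) A = emeasure \<nu> A"
    by (subst emeasure_bind[where N=borel]) simp_all
qed

text \<open>By invariance, a \<open>\<nu>\<close>-null set is charged by \<open>m x\<close> only for a null set of starting
  points \<open>x\<close>.\<close>

lemma AE_walk:
  assumes "AE x in \<nu>. P x"
  shows "AE x in \<nu>. AE y in m x. P y"
proof -
  obtain N where N: "{x \<in> space \<nu>. \<not> P x} \<subseteq> N" "N \<in> null_sets \<nu>"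
    using AE_E[OF assms] by (metis null_setsI)
  then have [measurable]: "N \<in> sets borel"
    using sets_nu by (auto dest: null_setsD2)
  have "AE x in \<nu> \<bind> m. x \<notin> N"
    unfolding bind_walk using N by (intro AE_not_in)
  then have "AE x in \<nu>. AE y in m x. y \<notin> N"
    by (subst (asm) AE_bind[where B=borel]) simp_all
  then show ?thesis
    using N by (auto elim!: eventually_mono)
qed

section \<open>The Rudin-Osher-Fatemi energy as one integral\<close>

text \<open>As each \<open>m x\<close> is a probability measure, the fidelity term may be put under the inner
  integral. Convexity and lower semicontinuity of the whole energy then reduce to pointwise
  statements about one nonnegative integrand. In contrast to the energy itself, whose fidelity term
  is a Bochner integral and vanishes when that integral does not exist, the integral below is
  infinite if \<open>u - f\<close> is not square-integrable and \<open>lam > 0\<close>; its finiteness thus places limits of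
  minimizing sequences in \<open>L\<^sup>2\<close>.\<close>

definition rof_density :: "real \<Rightarrow> ('a \<Rightarrow> real) \<Rightarrow> ('a \<Rightarrow> real) \<Rightarrow> 'a \<Rightarrow> 'a \<Rightarrow> real" where
  "rof_density lam f u x y = \<bar>u y - u x\<bar> / 2 + lam / 2 * (u x - f x)\<^sup>2"

definition rof_integral :: "real \<Rightarrow> ('a \<Rightarrow> real) \<Rightarrow> ('a \<Rightarrow> real) \<Rightarrow> ennreal" where
  "rof_integral lam f u = (\<integral>\<^sup>+x. (\<integral>\<^sup>+y. ennreal (rof_density lam f u x y) \<partial>m x) \<partial>\<nu>)"

lemma L2_borel_measurable: "u \<in> L2 \<nu> \<Longrightarrow> u \<in> borel_measurable borel"
  using L2_measurable[of u \<nu>] by (simp add: measurable_cong_sets[OF sets_nu refl])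

lemma walk_integral_measurable [measurable (raw)]:
  assumes "(\<lambda>(x, y). g x y) \<in> borel_measurable (borel \<Otimes>\<^sub>M borel)"
  shows "(\<lambda>x. \<integral>\<^sup>+y. g x y \<partial>m x) \<in> borel_measurable \<nu>"
  by (rule nn_integral_measurable_subprob_algebra2[OF _ walk_kernel])
    (use assms in \<open>simp add: measurable_cong_sets[OF sets_pair_measure_cong[OF sets_nu refl] refl]\<close>)

lemma rof_density_measurable [measurable]:
  assumes [measurable]: "f \<in> borel_measurable borel" "u \<in> borel_measurable borel"
  shows "(\<lambda>(x, y). rof_density lam f u x y) \<in> borel_measurable (borel \<Otimes>\<^sub>M borel)"
  unfolding rof_density_def by measurable

lemma rof_integral_eq:
  assumes [measurable]: "f \<in> borel_measurable borel" "u \<in> borel_measurable borel" and "0 \<le> lam"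
  shows "rof_integral lam f u = TV m \<nu> u + ennreal (lam / 2) * (\<integral>\<^sup>+x. ennreal ((u x - f x)\<^sup>2) \<partial>\<nu>)"
proof -
  have inner: "(\<integral>\<^sup>+y. ennreal (rof_density lam f u x y) \<partial>m x) =
      (1/2) * (\<integral>\<^sup>+y. ennreal \<bar>u y - u x\<bar> \<partial>m x) + ennreal (lam / 2) * ennreal ((u x - f x)\<^sup>2)" for x
  proof -
    have "ennreal (rof_density lam f u x y) =
        (1/2) * ennreal \<bar>u y - u x\<bar> + ennreal (lam / 2) * ennreal ((u x - f x)\<^sup>2)" for y
    proof -
      have "(1/2) * ennreal \<bar>u y - u x\<bar> = ennreal (1/2) * ennreal \<bar>u y - u x\<bar>"
        by (simp add: divide_ennreal_def)
      also have "\<dots> = ennreal (\<bar>u y - u x\<bar> / 2)"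
        by (subst ennreal_mult[symmetric]) simp_all
      finally have "(1/2) * ennreal \<bar>u y - u x\<bar> = ennreal (\<bar>u y - u x\<bar> / 2)" .
      moreover have "ennreal (lam / 2) * ennreal ((u x - f x)\<^sup>2) = ennreal (lam / 2 * (u x - f x)\<^sup>2)"
        using \<open>0 \<le> lam\<close> by (intro ennreal_mult[symmetric]) auto
      ultimately show ?thesis
        using \<open>0 \<le> lam\<close> unfolding rof_density_def by (simp only:) (intro ennreal_plus, auto)
    qed
    then show ?thesis
      by (simp add: nn_integral_add nn_integral_cmult)
  qed
  show ?thesis
    unfolding rof_integral_def inner TV_def
    by (simp add: nn_integral_add nn_integral_cmult)
qed

lemma rof_integral_eq_ROF_energy:
  assumes "f \<in> L2 \<nu>" "u \<in> L2 \<nu>" "0 \<le> lam"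
  shows "rof_integral lam f u = ROF_energy m \<nu> lam f u"
  using assms L2_square_integrable[OF L2_diff[OF assms(2,1)]]
  by (simp add: rof_integral_eq L2_borel_measurable ROF_energy_def nn_integral_eq_integral
      flip: ennreal_mult)

lemma rof_density_strongly_convex:
  assumes "0 \<le> s" "s \<le> 1" "0 \<le> lam"
  shows "rof_density lam f (\<lambda>x. (1 - s) * u x + s * w x) x y + lam / 2 * s * (1 - s) * (u x - w x)\<^sup>2
    \<le> (1 - s) * rof_density lam f u x y + s * rof_density lam f w x y"
proof -
  let ?z = "\<lambda>x. (1 - s) * u x + s * w x"
  have "\<bar>?z y - ?z x\<bar> = \<bar>(1 - s) * (u y - u x) + s * (w y - w x)\<bar>"
    by (simp add: algebra_simps)
  also have "\<dots> \<le> (1 - s) * \<bar>u y - u x\<bar> + s * \<bar>w y - w x\<bar>"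
    using assms by (intro order_trans[OF abs_triangle_ineq]) (simp add: abs_mult)
  finally have 1: "\<bar>?z y - ?z x\<bar> \<le> (1 - s) * \<bar>u y - u x\<bar> + s * \<bar>w y - w x\<bar>" .
  \<comment> \<open>the parallelogram-type identity that is the source of the modulus of convexity\<close>
  have 2: "(?z x - f x)\<^sup>2 + s * (1 - s) * (u x - w x)\<^sup>2 = (1 - s) * (u x - f x)\<^sup>2 + s * (w x - f x)\<^sup>2"
    by (simp add: power2_eq_square algebra_simps)
  have "lam / 2 * (?z x - f x)\<^sup>2 + lam / 2 * s * (1 - s) * (u x - w x)\<^sup>2 =
      lam / 2 * ((?z x - f x)\<^sup>2 + s * (1 - s) * (u x - w x)\<^sup>2)"
    by (simp add: field_simps)
  also have "\<dots> = (1 - s) * (lam / 2 * (u x - f x)\<^sup>2) + s * (lam / 2 * (w x - f x)\<^sup>2)"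
    unfolding 2 by (simp add: field_simps)
  finally show ?thesis
    using 1 unfolding rof_density_def by (simp add: distrib_left)
qed

lemma ROF_energy_strongly_convex:
  assumes f: "f \<in> L2 \<nu>" and u: "u \<in> L2 \<nu>" and w: "w \<in> L2 \<nu>"
    and s: "0 \<le> s" "s \<le> 1" and lam: "0 \<le> lam"
  shows "ROF_energy m \<nu> lam f (\<lambda>x. (1 - s) * u x + s * w x)
      + ennreal (lam / 2 * s * (1 - s) * (L2_norm \<nu> (\<lambda>x. u x - w x))\<^sup>2)
    \<le> ennreal (1 - s) * ROF_energy m \<nu> lam f u + ennreal s * ROF_energy m \<nu> lam f w"
proof -
  note [measurable] = L2_borel_measurable[OF f] L2_borel_measurable[OF u] L2_borel_measurable[OF w]
  define z where "z = (\<lambda>x. (1 - s) * u x + s * w x)"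
  have z: "z \<in> L2 \<nu>"
    unfolding z_def by (intro L2_add L2_scale u w)
  have zm [measurable]: "z \<in> borel_measurable borel"
    by (rule L2_borel_measurable[OF z])
  define c where "c = lam / 2 * s * (1 - s)"
  have c: "0 \<le> c"
    using s lam by (simp add: c_def)
  have dens_nonneg: "0 \<le> rof_density lam f g x y" for g x y
    using lam by (simp add: rof_density_def)
  have "ennreal (c * (L2_norm \<nu> (\<lambda>x. u x - w x))\<^sup>2) = (\<integral>\<^sup>+x. ennreal (c * (u x - w x)\<^sup>2) \<partial>\<nu>)"
    using c L2_square_integrable[OF L2_diff[OF u w]]
    by (subst nn_integral_eq_integral) (simp_all add: L2_norm_power2)
  also have "\<dots> = (\<integral>\<^sup>+x. (\<integral>\<^sup>+y. ennreal (c * (u x - w x)\<^sup>2) \<partial>m x) \<partial>\<nu>)"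
    by simp
  finally have quad: "ennreal (c * (L2_norm \<nu> (\<lambda>x. u x - w x))\<^sup>2) =
      (\<integral>\<^sup>+x. (\<integral>\<^sup>+y. ennreal (c * (u x - w x)\<^sup>2) \<partial>m x) \<partial>\<nu>)" .
  have "rof_integral lam f z + ennreal (c * (L2_norm \<nu> (\<lambda>x. u x - w x))\<^sup>2) =
      (\<integral>\<^sup>+x. (\<integral>\<^sup>+y. ennreal (rof_density lam f z x y + c * (u x - w x)\<^sup>2) \<partial>m x) \<partial>\<nu>)"
    using c dens_nonneg unfolding quad rof_integral_def
    by (simp add: ennreal_plus nn_integral_add)
  also have "\<dots> \<le> (\<integral>\<^sup>+x. (\<integral>\<^sup>+y. ennreal ((1 - s) * rof_density lam f u x y
      + s * rof_density lam f w x y) \<partial>m x) \<partial>\<nu>)"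
    using rof_density_strongly_convex[OF s lam] unfolding z_def c_def
    by (intro nn_integral_mono ennreal_leI)
  also have "\<dots> = ennreal (1 - s) * rof_integral lam f u + ennreal s * rof_integral lam f w"
    using s dens_nonneg unfolding rof_integral_def
    by (simp add: ennreal_plus ennreal_mult nn_integral_add nn_integral_cmult)
  finally show ?thesis
    using f u w z lam by (simp add: rof_integral_eq_ROF_energy z_def c_def)
qed

text \<open>Fatou's lemma, once for the inner and once for the outer integral.\<close>

lemma rof_integral_lsc:
  assumes [measurable]: "f \<in> borel_measurable borel" "u \<in> borel_measurable borel"
      "\<And>n. v n \<in> borel_measurable borel"
    and lim: "AE x in \<nu>. (\<lambda>n. v n x) \<longlonglongrightarrow> u x"
  shows "rof_integral lam f u \<le> liminf (\<lambda>n. rof_integral lam f (v n))"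
proof -
  have "rof_integral lam f u \<le> (\<integral>\<^sup>+x. liminf (\<lambda>n. \<integral>\<^sup>+y. ennreal (rof_density lam f (v n) x y) \<partial>m x) \<partial>\<nu>)"
    unfolding rof_integral_def
  proof (rule nn_integral_mono_AE)
    show "AE x in \<nu>. (\<integral>\<^sup>+y. ennreal (rof_density lam f u x y) \<partial>m x)
        \<le> liminf (\<lambda>n. \<integral>\<^sup>+y. ennreal (rof_density lam f (v n) x y) \<partial>m x)"
      using lim AE_walk[OF lim]
    proof eventually_elim
      case (elim x)
      have "AE y in m x. ennreal (rof_density lam f u x y) =
          liminf (\<lambda>n. ennreal (rof_density lam f (v n) x y))"
        using elim(2)
      proof eventually_elim
        case (elim y)
        have "(\<lambda>n. rof_density lam f (v n) x y) \<longlonglongrightarrow> rof_density lam f u x y"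
          unfolding rof_density_def using elim \<open>(\<lambda>n. v n x) \<longlonglongrightarrow> u x\<close>
          by (intro tendsto_intros) auto
        then have "(\<lambda>n. ennreal (rof_density lam f (v n) x y)) \<longlonglongrightarrow> ennreal (rof_density lam f u x y)"
          by (rule tendsto_ennrealI)
        then show ?case
          by (simp add: lim_imp_Liminf)
      qed
      then have "(\<integral>\<^sup>+y. ennreal (rof_density lam f u x y) \<partial>m x) =
          (\<integral>\<^sup>+y. liminf (\<lambda>n. ennreal (rof_density lam f (v n) x y)) \<partial>m x)"
        by (rule nn_integral_cong_AE)
      also have "\<dots> \<le> liminf (\<lambda>n. \<integral>\<^sup>+y. ennreal (rof_density lam f (v n) x y) \<partial>m x)"
        by (rule nn_integral_liminf) measurable
      finally show ?case .
    qed
  qed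
  also have "\<dots> \<le> liminf (\<lambda>n. rof_integral lam f (v n))"
    unfolding rof_integral_def by (rule nn_integral_liminf) measurable
  finally show ?thesis .
qed

section \<open>The minimizer of the energy\<close>

text \<open>Compare \<open>u\<close> with \<open>(1 - s) u + s w\<close>: minimality and strong convexity give
  \<open>E u + (1 - s) lam/2 \<parallel>u - w\<parallel>\<^sup>2 \<le> E w\<close> after division by \<open>s\<close>, and \<open>s\<close> tends to \<open>0\<close>.\<close>

lemma ROF_energy_quadratic_growth:
  assumes f: "f \<in> L2 \<nu>" and u: "u \<in> L2 \<nu>" and w: "w \<in> L2 \<nu>" and lam: "0 \<le> lam"
    and min: "\<And>z. z \<in> L2 \<nu> \<Longrightarrow> ROF_energy m \<nu> lam f u \<le> ROF_energy m \<nu> lam f z"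
    and u_fin: "ROF_energy m \<nu> lam f u < \<infinity>"
  shows "ROF_energy m \<nu> lam f u + ennreal (lam / 2 * (L2_norm \<nu> (\<lambda>x. u x - w x))\<^sup>2)
    \<le> ROF_energy m \<nu> lam f w"
proof (cases "ROF_energy m \<nu> lam f w = \<infinity>")
  case False
  define D where "D = lam / 2 * (L2_norm \<nu> (\<lambda>x. u x - w x))\<^sup>2"
  have D: "0 \<le> D"
    using lam by (simp add: D_def)
  obtain e where e: "ROF_energy m \<nu> lam f u = ennreal e" "0 \<le> e"
    using u_fin by (cases "ROF_energy m \<nu> lam f u") auto
  obtain e' where e': "ROF_energy m \<nu> lam f w = ennreal e'" "0 \<le> e'"
    using False by (cases "ROF_energy m \<nu> lam f w") auto
  have "e + (1 - s) * D \<le> e'" if s: "0 < s" "s < 1" for s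
  proof -
    have "(\<lambda>x. (1 - s) * u x + s * w x) \<in> L2 \<nu>"
      by (intro L2_add L2_scale u w)
    then have "ennreal e + ennreal (s * (1 - s) * D) \<le>
        ROF_energy m \<nu> lam f (\<lambda>x. (1 - s) * u x + s * w x) + ennreal (s * (1 - s) * D)"
      unfolding e(1)[symmetric] by (intro add_right_mono min)
    also have "\<dots> \<le> ennreal (1 - s) * ennreal e + ennreal s * ennreal e'"
      using ROF_energy_strongly_convex[OF f u w _ _ lam, of s] s
      by (simp add: e(1) e'(1) D_def mult_ac)
    also have "\<dots> = ennreal ((1 - s) * e + s * e')"
      using s e(2) e'(2) by (simp add: ennreal_plus ennreal_mult)
    finally have "e + s * (1 - s) * D \<le> (1 - s) * e + s * e'"
      using s e(2) e'(2) D by (simp add: ennreal_plus[symmetric] del: ennreal_plus)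
    then have "s * (e + (1 - s) * D) \<le> s * e'"
      by (simp add: algebra_simps)
    then show ?thesis
      using s by simp
  qed
  then have "eventually (\<lambda>s. e + (1 - s) * D \<le> e') (at_right 0)"
    by (auto simp: eventually_at_right_field intro!: exI[of _ 1])
  moreover have "((\<lambda>s. e + (1 - s) * D) \<longlongrightarrow> e + (1 - 0) * D) (at_right 0)"
    by (intro tendsto_intros)
  ultimately have "e + (1 - 0) * D \<le> e'"
    by (intro tendsto_upperbound[where F="at_right 0"]) auto
  then have "ennreal (e + D) \<le> ennreal e'"
    by (intro ennreal_leI) simp
  then show ?thesis
    unfolding e(1) e'(1) D_def[symmetric] using e(2) D by simp
qed simp

text \<open>Take \<open>v n\<close> with energy within \<open>4\<^sup>-\<^sup>n\<close> of the infimum. Strong convexity at the midpoint of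
  \<open>v n\<close> and \<open>v (Suc n)\<close> bounds their distance by a multiple of \<open>2\<^sup>-\<^sup>n\<close>, so the sequence converges almost
  everywhere, and lower semicontinuity shows that the limit attains the infimum.\<close>

lemma ROF_minimizer_exists:
  assumes f: "f \<in> L2 \<nu>" and lam: "0 < lam"
  obtains u where "u \<in> L2 \<nu>" "ROF_energy m \<nu> lam f u < \<infinity>"
    "\<And>w. w \<in> L2 \<nu> \<Longrightarrow> ROF_energy m \<nu> lam f u \<le> ROF_energy m \<nu> lam f w"
proof -
  let ?E = "ROF_energy m \<nu> lam f"
  define I where "I = (INF w\<in>L2 \<nu>. ?E w)"
  have I_le: "I \<le> ?E w" if "w \<in> L2 \<nu>" for w
    unfolding I_def using that by (rule INF_lower)
  have "?E (\<lambda>x. 0) < \<infinity>"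
    by (simp add: ROF_energy_def TV_def)
  then have "I < \<infinity>"
    using I_le[OF L2_const[of 0]] by (rule order.strict_trans1[rotated])
  then obtain i where i: "I = ennreal i" "0 \<le> i"
    by (cases I) auto
  have "\<exists>w. w \<in> L2 \<nu> \<and> ?E w < ennreal (i + (1 / 4) ^ n)" for n
  proof -
    have "I < ennreal (i + (1 / 4) ^ n)"
      using i by (simp add: ennreal_less_iff)
    then show ?thesis
      unfolding I_def INF_less_iff by auto
  qed
  then have "\<exists>v. \<forall>n. v n \<in> L2 \<nu> \<and> ?E (v n) < ennreal (i + (1 / 4) ^ n)"
    by (intro choice allI)
  then obtain v where v: "\<And>n. v n \<in> L2 \<nu>" and vE: "\<And>n. ?E (v n) < ennreal (i + (1 / 4) ^ n)"
    by blast
  have close: "lam / 8 * (L2_norm \<nu> (\<lambda>x. v (Suc n) x - v n x))\<^sup>2 \<le> (1 / 4) ^ n" for n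
  proof -
    define D where "D = (L2_norm \<nu> (\<lambda>x. v (Suc n) x - v n x))\<^sup>2"
    have D: "0 \<le> lam / 8 * D"
      using lam by (simp add: D_def)
    have le: "?E (v k) \<le> ennreal (i + (1 / 4) ^ n)" if "k = n \<or> k = Suc n" for k
    proof -
      have "(1 / 4 :: real) ^ k \<le> (1 / 4) ^ n"
        using that by (intro power_decreasing) auto
      then have "ennreal (i + (1 / 4) ^ k) \<le> ennreal (i + (1 / 4) ^ n)"
        by (intro ennreal_leI add_left_mono)
      with less_imp_le[OF vE] show ?thesis
        by (rule order_trans)
    qed
    have "(\<lambda>x. (1 - 1/2) * v (Suc n) x + 1/2 * v n x) \<in> L2 \<nu>"
      by (intro L2_add L2_scale v)
    then have "ennreal i + ennreal (lam / 8 * D) \<le>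
        ?E (\<lambda>x. (1 - 1/2) * v (Suc n) x + 1/2 * v n x) + ennreal (lam / 8 * D)"
      unfolding i(1)[symmetric] by (intro add_right_mono I_le)
    also have "\<dots> \<le> ennreal (1 - 1/2) * ?E (v (Suc n)) + ennreal (1/2) * ?E (v n)"
      using ROF_energy_strongly_convex[OF f v[of "Suc n"] v[of n], of "1/2" lam] lam
      by (simp add: D_def)
    also have "\<dots> \<le> ennreal (1 - 1/2) * ennreal (i + (1 / 4) ^ n) + ennreal (1/2) * ennreal (i + (1 / 4) ^ n)"
      by (intro add_mono mult_left_mono le) auto
    also have "\<dots> = ennreal (i + (1 / 4) ^ n)"
    proof -
      have "ennreal (1 - 1/2) + ennreal (1/2) = 1"
        by (subst ennreal_plus[symmetric]) simp_all
      then show ?thesis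
        by (simp only: distrib_right[symmetric] mult_1_left)
    qed
    finally show ?thesis
      using i(2) D by (simp add: D_def ennreal_plus[symmetric] del: ennreal_plus)
  qed
  have geom: "L2_norm \<nu> (\<lambda>x. v (Suc n) x - v n x) \<le> sqrt (8 / lam) * (1 / 2) ^ n" for n
  proof (rule power2_le_imp_le)
    have "((1 / 2) ^ n)\<^sup>2 = (1 / 4 :: real) ^ n"
      by (simp add: power2_eq_square flip: power_mult_distrib)
    then show "(L2_norm \<nu> (\<lambda>x. v (Suc n) x - v n x))\<^sup>2 \<le> (sqrt (8 / lam) * (1 / 2) ^ n)\<^sup>2"
      using close[of n] lam by (simp add: power_mult_distrib field_simps)
  qed (use lam in simp)
  define u where "u x = lim (\<lambda>n. v n x)" for x
  have lim: "AE x in \<nu>. (\<lambda>n. v n x) \<longlonglongrightarrow> u x"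
    using AE_convergent_of_geometric_L2[OF v geom]
    by eventually_elim (simp add: u_def convergent_LIMSEQ_iff)
  note [measurable] = L2_borel_measurable[OF v] L2_borel_measurable[OF f]
  have [measurable]: "u \<in> borel_measurable borel"
    unfolding u_def by measurable
  have "rof_integral lam f u \<le> liminf (\<lambda>n. rof_integral lam f (v n))"
    by (rule rof_integral_lsc[OF _ _ _ lim]) measurable
  also have "\<dots> \<le> liminf (\<lambda>n. ennreal (i + (1 / 4) ^ n))"
    using vE f v lam by (intro Liminf_mono) (auto simp: rof_integral_eq_ROF_energy intro!: always_eventually less_imp_le)
  also have "\<dots> = ennreal (i + 0)"
    by (intro lim_imp_Liminf tendsto_ennrealI tendsto_intros LIMSEQ_power_zero) auto
  finally have le: "rof_integral lam f u \<le> I"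
    using i by simp
  have "ennreal (lam / 2) * (\<integral>\<^sup>+x. ennreal ((u x - f x)\<^sup>2) \<partial>\<nu>) \<le> rof_integral lam f u"
    using lam by (simp add: rof_integral_eq)
  also have "\<dots> < \<infinity>"
    using le \<open>I < \<infinity>\<close> by simp
  finally have "(\<integral>\<^sup>+x. ennreal ((u x - f x)\<^sup>2) \<partial>\<nu>) < \<infinity>"
    using lam by (auto simp: ennreal_mult_less_top)
  then have "(\<lambda>x. u x - f x) \<in> L2 \<nu>"
    unfolding L2_def by (auto intro!: integrableI_nonneg simp: measurable_cong_sets[OF sets_nu refl])
  from L2_add[OF this f] have u: "u \<in> L2 \<nu>"
    by simp
  have "?E u \<le> I"
    using le rof_integral_eq_ROF_energy[OF f u] lam by simp
  then show thesis
    using u \<open>I < \<infinity>\<close> I_le by (intro that[of u]) (auto intro: le_less_trans order_trans)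
qed

lemma minimizer_is_unique_ROF_minimizer:
  assumes f: "f \<in> L2 \<nu>" and lam: "0 < lam" and u: "u \<in> L2 \<nu>"
    and fin: "ROF_energy m \<nu> lam f u < \<infinity>"
    and min: "\<And>w. w \<in> L2 \<nu> \<Longrightarrow> ROF_energy m \<nu> lam f u \<le> ROF_energy m \<nu> lam f w"
  shows "is_unique_ROF_minimizer m \<nu> lam f u"
  unfolding is_unique_ROF_minimizer_def
proof (intro conjI allI impI)
  show "is_arg_min (ROF_energy m \<nu> lam f) (\<lambda>w. w \<in> L2 \<nu>) u"
    using u min by (auto simp: is_arg_min_def not_less)
  fix w assume "is_arg_min (ROF_energy m \<nu> lam f) (\<lambda>w. w \<in> L2 \<nu>) w"
  then have w: "w \<in> L2 \<nu>" and w_le: "ROF_energy m \<nu> lam f w \<le> ROF_energy m \<nu> lam f u"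
    using u by (auto simp: is_arg_min_def not_less)
  have "ROF_energy m \<nu> lam f u + ennreal (lam / 2 * (L2_norm \<nu> (\<lambda>x. u x - w x))\<^sup>2)
      \<le> ROF_energy m \<nu> lam f w"
    by (rule ROF_energy_quadratic_growth[OF f u w less_imp_le[OF lam] min fin])
  from order_trans[OF this w_le]
  have "ROF_energy m \<nu> lam f u + ennreal (lam / 2 * (L2_norm \<nu> (\<lambda>x. u x - w x))\<^sup>2)
      \<le> ROF_energy m \<nu> lam f u + 0"
    by simp
  then have "ennreal (lam / 2 * (L2_norm \<nu> (\<lambda>x. u x - w x))\<^sup>2) \<le> 0"
    using fin by (subst (asm) ennreal_add_left_cancel_le) auto
  then have "(L2_norm \<nu> (\<lambda>x. u x - w x))\<^sup>2 \<le> 0"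
    using lam by (simp add: ennreal_eq_0_iff mult_le_0_iff)
  then have "(\<integral>x. (u x - w x)\<^sup>2 \<partial>\<nu>) = 0"
    unfolding L2_norm_power2 by (intro antisym) auto
  then have "AE x in \<nu>. (u x - w x)\<^sup>2 = 0"
    using L2_square_integrable[OF L2_diff[OF u w]] by (subst (asm) integral_nonneg_eq_0_iff_AE) auto
  then show "AE x in \<nu>. w x = u x"
    by eventually_elim simp
qed

text \<open>The Euler-Lagrange inclusion \<open>lam (f - u) \<in> \<partial>TV u\<close>. It is quadratic growth rewritten: in the
  expansion of \<open>\<parallel>w - f\<parallel>\<^sup>2\<close> around \<open>u\<close> the terms \<open>\<parallel>u - f\<parallel>\<^sup>2\<close> and \<open>\<parallel>u - w\<parallel>\<^sup>2\<close> cancel, and the mixed term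
  remains.\<close>

lemma minimizer_variational_inequality:
  assumes f: "f \<in> L2 \<nu>" and lam: "0 \<le> lam" and u: "u \<in> L2 \<nu>" and w: "w \<in> L2 \<nu>"
    and fin: "ROF_energy m \<nu> lam f u < \<infinity>"
    and min: "\<And>z. z \<in> L2 \<nu> \<Longrightarrow> ROF_energy m \<nu> lam f u \<le> ROF_energy m \<nu> lam f z"
    and a: "TV m \<nu> u = ennreal a" "0 \<le> a" and b: "TV m \<nu> w = ennreal b" "0 \<le> b"
  shows "a + lam * (\<integral>x. (f x - u x) * (w x - u x) \<partial>\<nu>) \<le> b"
proof -
  let ?n = "\<lambda>g. (L2_norm \<nu> g)\<^sup>2"
  have E: "ROF_energy m \<nu> lam f z = ennreal (c + lam / 2 * ?n (\<lambda>x. z x - f x))"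
    if "TV m \<nu> z = ennreal c" "0 \<le> c" for z c
    using that lam by (simp add: ROF_energy_def L2_norm_power2 ennreal_plus)
  have "ennreal (a + lam / 2 * ?n (\<lambda>x. u x - f x) + lam / 2 * ?n (\<lambda>x. u x - w x))
      \<le> ennreal (b + lam / 2 * ?n (\<lambda>x. w x - f x))"
    using ROF_energy_quadratic_growth[OF f u w lam min fin] E[OF a] E[OF b] a b lam
    by (simp add: ennreal_plus)
  then have "a + lam / 2 * ?n (\<lambda>x. u x - f x) + lam / 2 * ?n (\<lambda>x. u x - w x)
      \<le> b + lam / 2 * ?n (\<lambda>x. w x - f x)"
    using b lam by (subst (asm) ennreal_le_iff) auto
  moreover have "?n (\<lambda>x. w x - f x) =
      ?n (\<lambda>x. u x - f x) + ?n (\<lambda>x. u x - w x) - 2 * (\<integral>x. (f x - u x) * (w x - u x) \<partial>\<nu>)"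
  proof -
    have "?n (\<lambda>x. w x - f x) = ?n (\<lambda>x. u x - f x) + 2 * (\<integral>x. (u x - f x) * (w x - u x) \<partial>\<nu>)
        + ?n (\<lambda>x. w x - u x)"
      using L2_norm_power2_add[OF L2_diff[OF u f] L2_diff[OF w u]] by simp
    moreover have "(\<integral>x. (u x - f x) * (w x - u x) \<partial>\<nu>) = - (\<integral>x. (f x - u x) * (w x - u x) \<partial>\<nu>)"
      by (simp add: left_diff_distrib flip: Bochner_Integration.integral_minus)
    ultimately show ?thesis
      by (simp add: L2_norm_minus_commute[of \<nu> w])
  qed
  ultimately show ?thesis
    by (simp add: algebra_simps)
qed

text \<open>Monotonicity of the subdifferential. The subgradient inequality at \<open>v\<close>, tested with \<open>u\<close>, and
  the one at \<open>u\<close>, tested with \<open>v\<close>, are added; \<open>f\<close> drops out because \<open>(v - f) + (f - u) = v - u\<close>.\<close>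

lemma flow_dissipation:
  assumes f: "f \<in> L2 \<nu>" and lam: "0 \<le> lam" and u: "u \<in> L2 \<nu>" and v: "v \<in> L2 \<nu>" and w: "w \<in> L2 \<nu>"
    and fin: "ROF_energy m \<nu> lam f u < \<infinity>"
    and min: "\<And>z. z \<in> L2 \<nu> \<Longrightarrow> ROF_energy m \<nu> lam f u \<le> ROF_energy m \<nu> lam f z"
    and flow: "(\<lambda>x. lam * (v x - f x) + w x) \<in> one_laplacian m \<nu> v"
  shows "(\<integral>x. w x * (v x - u x) \<partial>\<nu>) \<le> - lam * (L2_norm \<nu> (\<lambda>x. v x - u x))\<^sup>2"
proof -
  let ?g = "\<lambda>x. lam * (v x - f x) + w x"
  have "TV m \<nu> u < \<infinity>"
    using fin by (simp add: ROF_energy_def)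
  then obtain a where a: "TV m \<nu> u = ennreal a" "0 \<le> a"
    by (cases "TV m \<nu> u") auto
  have "enn2ereal (TV m \<nu> v) < \<infinity>" and
    sub: "enn2ereal (TV m \<nu> v) + ereal (\<integral>x. - ?g x * (u x - v x) \<partial>\<nu>) \<le> enn2ereal (TV m \<nu> u)"
    using flow u unfolding one_laplacian_def L2_subdifferential_def by blast+
  then obtain b where b: "TV m \<nu> v = ennreal b" "0 \<le> b"
    by (cases "TV m \<nu> v") auto
  have "b + (\<integral>x. - ?g x * (u x - v x) \<partial>\<nu>) \<le> a"
    using sub a b by (simp add: enn2ereal_ennreal)
  moreover have "(\<integral>x. - ?g x * (u x - v x) \<partial>\<nu>) = (\<integral>x. ?g x * (v x - u x) \<partial>\<nu>)"
    by (simp add: algebra_simps)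
  moreover have "a + lam * (\<integral>x. (f x - u x) * (v x - u x) \<partial>\<nu>) \<le> b"
    by (rule minimizer_variational_inequality[OF f lam u v fin min a b])
  moreover have "(\<integral>x. ?g x * (v x - u x) \<partial>\<nu>) + lam * (\<integral>x. (f x - u x) * (v x - u x) \<partial>\<nu>) =
      (\<integral>x. w x * (v x - u x) \<partial>\<nu>) + lam * (L2_norm \<nu> (\<lambda>x. v x - u x))\<^sup>2"
  proof -
    note [simp] = L2_mult_integrable[OF L2_diff[OF v f] L2_diff[OF v u]]
      L2_mult_integrable[OF w L2_diff[OF v u]] L2_mult_integrable[OF L2_diff[OF f u] L2_diff[OF v u]]
    have "(\<integral>x. ?g x * (v x - u x) \<partial>\<nu>) = lam * (\<integral>x. (v x - f x) * (v x - u x) \<partial>\<nu>)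
        + (\<integral>x. w x * (v x - u x) \<partial>\<nu>)"
      by (simp add: distrib_right mult.assoc)
    moreover have "(L2_norm \<nu> (\<lambda>x. v x - u x))\<^sup>2 =
        (\<integral>x. (v x - f x) * (v x - u x) + (f x - u x) * (v x - u x) \<partial>\<nu>)"
      unfolding L2_norm_power2 by (simp add: power2_eq_square algebra_simps)
    moreover have "\<dots> = (\<integral>x. (v x - f x) * (v x - u x) \<partial>\<nu>) + (\<integral>x. (f x - u x) * (v x - u x) \<partial>\<nu>)"
      by simp
    ultimately show ?thesis
      by (simp add: distrib_left)
  qed
  ultimately show ?thesis
    by linarith
qed

lemma ROF_minimizer_attracts_flow:
  assumes lam: "0 \<le> lam" and f: "f \<in> L2 \<nu>" and u: "u \<in> L2 \<nu>" and v0: "v0 \<in> L2 \<nu>"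
    and fin: "ROF_energy m \<nu> lam f u < \<infinity>"
    and min: "\<And>z. z \<in> L2 \<nu> \<Longrightarrow> ROF_energy m \<nu> lam f u \<le> ROF_energy m \<nu> lam f z"
    and v: "strong_solution m \<nu> lam f v0 v" and t: "0 \<le> t"
  shows "L2_norm \<nu> (\<lambda>x. v t x - u x) \<le> L2_norm \<nu> (\<lambda>x. v0 x - u x) * exp (- lam * t)"
proof -
  \<comment> \<open>any time horizon beyond \<open>t\<close> would do\<close>
  have "0 < t + 1"
    using t by simp
  then obtain w where cont: "L2_continuous_on \<nu> {0..t + 1} v" and w: "W11_loc_deriv \<nu> 0 (t + 1) v w"
    and flow: "AE r in lebesgue_on {0<..<t + 1}. (\<lambda>x. lam * (v r x - f x) + w r x) \<in> one_laplacian m \<nu> (v r)"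
    using v unfolding strong_solution_def by blast
  have vL2: "v r \<in> L2 \<nu>" if "r \<in> {0..t + 1}" for r
    using cont that by (simp add: L2_continuous_on_def)
  have "AE r in lebesgue_on {0<..<t + 1}.
      (\<integral>x. w r x * (v r x - u x) \<partial>\<nu>) \<le> - lam * (L2_norm \<nu> (\<lambda>x. v r x - u x))\<^sup>2"
    using flow AE_space
  proof eventually_elim
    case (elim r)
    then have r: "0 < r" "r < t + 1"
      by auto
    then have "w r \<in> L2 \<nu>"
      using w unfolding W11_loc_deriv_def has_L2_integral_def by (metis atLeastAtMost_iff order_refl)
    then show ?case
      using r elim(1) by (intro flow_dissipation[OF f lam u vL2 _ fin min]) auto
  qed
  then have "L2_norm \<nu> (\<lambda>x. v t x - u x) \<le> L2_norm \<nu> (\<lambda>x. v 0 x - u x) * exp (- lam * t)"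
    using t lam by (intro L2_exp_decay[OF cont w u]) auto
  also have "L2_norm \<nu> (\<lambda>x. v 0 x - u x) = L2_norm \<nu> (\<lambda>x. v0 x - u x)"
    using v vL2[of 0] t u v0 by (intro L2_norm_cong_AE L2_diff) (auto simp: strong_solution_def)
  finally show ?thesis .
qed

end

theorem theorem2p11:
  fixes m :: "'a::polish_space \<Rightarrow> 'a measure" and \<nu> :: "'a measure"
    and lam :: real and f :: "'a \<Rightarrow> real"
    and T :: "real \<Rightarrow> ('a \<Rightarrow> real) \<Rightarrow> ('a \<Rightarrow> real)"
  assumes "reversible_ergodic_space m \<nu>"
    and "lam > 0"
    and "f \<in> L2 \<nu>"
    and "is_solution_semigroup m \<nu> lam f T"
  shows "\<exists>u. is_unique_ROF_minimizer m \<nu> lam f u \<and>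
           (\<forall>v0\<in>L2 \<nu>. \<forall>t\<ge>0.
              L2_norm \<nu> (\<lambda>x. T t v0 x - u x) \<le> L2_norm \<nu> (\<lambda>x. v0 x - u x) * exp (- lam * t))"
proof -
  interpret reversible_walk m \<nu>
    using assms(1) by (intro reversible_walk.intro) (simp_all add: reversible_ergodic_space_def)
  obtain u where u: "u \<in> L2 \<nu>" "ROF_energy m \<nu> lam f u < \<infinity>"
    and min: "\<And>w. w \<in> L2 \<nu> \<Longrightarrow> ROF_energy m \<nu> lam f u \<le> ROF_energy m \<nu> lam f w"
    by (rule ROF_minimizer_exists[OF assms(3,2)]) blast
  show ?thesis
  proof (intro exI[of _ u] conjI ballI allI impI)
    show "is_unique_ROF_minimizer m \<nu> lam f u"
      by (rule minimizer_is_unique_ROF_minimizer[OF assms(3,2) u min])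
    fix v0 and t :: real assume v0: "v0 \<in> L2 \<nu>" and t: "0 \<le> t"
    have "strong_solution m \<nu> lam f v0 (\<lambda>t. T t v0)"
      using assms(4) v0 by (simp add: is_solution_semigroup_def)
    from ROF_minimizer_attracts_flow[OF less_imp_le[OF assms(2)] assms(3) u(1) v0 u(2) min this t]
    show "L2_norm \<nu> (\<lambda>x. T t v0 x - u x) \<le> L2_norm \<nu> (\<lambda>x. v0 x - u x) * exp (- lam * t)" .
  qed
qed

end
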